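(* Let $\Delta$ be a pure flag simplicial complex and let $\mathbb{F}$ be a field with $\mathrm{char}(\mathbb{F}) = 0$. Then the following conditions are equivalent: (i) $A_{\Delta}$ has a quadratic Gröbner basis; (ii) $R_{\Delta}$ has a quadratic Gröbner basis; (iii) $\Delta$ is shellable.
   Context: Simplicial complexes. A simplicial complex $\Delta$ on $[n]=\{1,\dots,n\}$ is a nonempty collection of subsets of $[n]$ closed under inclusion; $\mathcal{F}(\Delta)$ is the set of its inclusion-maximal elements (facets). $\dim F=|F|-1$, $\dim\Delta$ is the maximal dimension of an element, and $\Delta$ is pure if all facets have the same dimension. The Stanley--Reisner ideal is $I_\Delta=(\prod_{i\in F}x_i : F\subseteq [n],\, F\notin\Delta)\subseteq\mathbb{F}[x_1,\dots,x_n]$; $\Delta$ is flag if $I_\Delta$ is generated by monomials of degree $2$ (possibly $I_\Delta=0$). $\langle F_1,\dots,F_r\rangle$ is the smallest simplicial complex containing $F_1,\dots,F_r$. A pure $(d-1)$-dimensional $\Delta$ is shellable if its facets can be linearly ordered $F_1,\dots,F_m$ so that $\langle F_1,\dots,F_{i-1}\rangle\cap\langle F_i\rangle$ is pure and $(d-2)$-dimensional for every $i=2,\dots,m$. The algebra $R_\Delta$. Let $\Delta$ be pure of dimension $d-1$, $S=\mathbb{F}[x_1,\dots,x_n,y_1,\dots,y_n]$, $I_\Gamma=I_\Delta S+(x_iy_i: i\in[n])$, $\mathbb{F}[\Gamma]=S/I_\Gamma$ (Cohen--Macaulay of dimension $n$) and $\omega=\mathrm{Ext}^n_S(\mathbb{F}[\Gamma],S(-2n))$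 its canonical module. Then $R_\Delta:=\mathbb{F}[\Gamma]\ltimes\omega(n-d-1)$ (Nagata idealization: $A\ltimes M=A\oplus M$ with $(a_1,m_1)(a_2,m_2)=(a_1a_2,a_1m_2+a_2m_1)$, graded by $(A\ltimes M)_j=A_j\oplus M_j$; $M(a)_j=M_{a+j}$). It is presented as $R_\Delta=T/J_\Delta$ with $T=S[z_F : F\in\mathcal{F}(\Delta)]$ and $$J_\Delta=I_\Gamma+(x_iz_F : i\notin F)+(\mathbf{y}^{F_1\setminus F_2}z_{F_1}-\mathbf{y}^{F_2\setminus F_1}z_{F_2} : F_1\ne F_2)+(z_F)^2,$$ with $F,F_1,F_2$ ranging over $\mathcal{F}(\Delta)$ and $\mathbf{y}^{G}=\prod_{i\in G}y_i$. The algebra $A_\Delta$. Let $f_\Delta=\sum_{F\in\mathcal{F}(\Delta)}z_F\prod_{i\in F}x_i$. $A_\Delta$ is the graded Artinian Gorenstein algebra associated with $f_\Delta$ via Macaulay's inverse system: $A_\Delta=Q/\mathrm{Ann}_Q(f_\Delta)$, where $Q=\mathbb{F}[x_i,z_F\mid i\in[n],F\in\mathcal{F}(\Delta)]$ acts on polynomials in variables with the same indexing by partial differentiation, and $\mathrm{Ann}_Q(f_\Delta)$ is the ideal of operators annihilating $f_\Delta$. "$R_\Delta$ (resp. $A_\Delta$) has a quadratic Gröbner basis" means that there is a term order on $T$ (resp. $Q$) with respect to which $J_\Delta$ (resp. $\mathrm{Ann}_Q(f_\Delta)$) has a Gröbner basis consisting of polynomials of degree $2$. *)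

theory Defs
  imports Complex_Main "HOL-Library.Poly_Mapping" "HOL-Algebra.Ideal"
begin

section \<open>Multivariate polynomials over a carrier set of variables\<close>

abbreviation keys :: "('a \<Rightarrow>\<^sub>0 'b::zero) \<Rightarrow> 'a set" where
  "keys \<equiv> Poly_Mapping.keys"

abbreviation lookup :: "('a \<Rightarrow>\<^sub>0 'b::zero) \<Rightarrow> 'a \<Rightarrow> 'b" where
  "lookup \<equiv> Poly_Mapping.lookup"

abbreviation single :: "'a \<Rightarrow> 'b::zero \<Rightarrow> ('a \<Rightarrow>\<^sub>0 'b)" where
  "single \<equiv> Poly_Mapping.single"

type_synonym 'v mon = "'v \<Rightarrow>\<^sub>0 nat"
type_synonym ('v, 'k) mpoly = "'v mon \<Rightarrow>\<^sub>0 'k"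

definition mons :: "'v set \<Rightarrow> 'v mon set" where
  "mons V = {m. keys m \<subseteq> V}"

definition mdeg :: "'v mon \<Rightarrow> nat" where
  "mdeg m = (\<Sum>v\<in>keys m. lookup m v)"

definition pdeg :: "('v, 'k::zero) mpoly \<Rightarrow> nat" where
  "pdeg p = Max (insert 0 (mdeg ` keys p))"

definition monomial :: "'v mon \<Rightarrow> ('v, 'k::zero_neq_one) mpoly" where
  "monomial m = single m 1"

definition var :: "'v \<Rightarrow> ('v, 'k::zero_neq_one) mpoly" where
  "var v = monomial (single v 1)"

definition poly_ring :: "'v set \<Rightarrow> ('v, 'k::comm_ring_1) mpoly ring" where
  "poly_ring V = \<lparr>carrier = {p. keys p \<subseteq> mons V}, mult = (*), one = 1, zero = 0, add = (+)\<rparr>"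

text \<open>Since \<open>Idl\<close> is an intersection over a locale predicate that includes the ring axioms,
  it is meaningful only because the following holds.\<close>

lemma mons_zero: "0 \<in> mons V"
  by (simp add: mons_def)

lemma mons_add: "a \<in> mons V \<Longrightarrow> b \<in> mons V \<Longrightarrow> a + b \<in> mons V"
  using Poly_Mapping.keys_add[of a b] by (auto simp: mons_def)

lemma cring_poly_ring: "cring (poly_ring V :: ('v, 'k::comm_ring_1) mpoly ring)"
proof (intro cringI abelian_groupI comm_monoidI)
  show "\<exists>y\<in>carrier (poly_ring V). y \<oplus>\<^bsub>poly_ring V\<^esub> x = \<zero>\<^bsub>poly_ring V\<^esub>"
    if "x \<in> carrier (poly_ring V)" for x :: "('v, 'k) mpoly"
    using that by (intro bexI[of _ "- x"]) (auto simp: poly_ring_def)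
next
  fix x y :: "('v, 'k) mpoly"
  assume "x \<in> carrier (poly_ring V)" "y \<in> carrier (poly_ring V)"
  then show "x \<oplus>\<^bsub>poly_ring V\<^esub> y \<in> carrier (poly_ring V)"
    using Poly_Mapping.keys_add[of x y] by (auto simp: poly_ring_def)
next
  fix x y :: "('v, 'k) mpoly"
  assume *: "x \<in> carrier (poly_ring V)" "y \<in> carrier (poly_ring V)"
  show "x \<otimes>\<^bsub>poly_ring V\<^esub> y \<in> carrier (poly_ring V)"
    using Poly_Mapping.keys_mult[of x y] * mons_add by (fastforce simp: poly_ring_def)
qed (auto simp: poly_ring_def algebra_simps mons_zero)


section \<open>Groebner bases\<close>

text \<open>\<open>(a, b) \<in> r\<close> means that \<open>a\<close> is at most \<open>b\<close>.\<close>

definition term_order :: "'v set \<Rightarrow> 'v mon rel \<Rightarrow> bool" where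
  "term_order V r \<longleftrightarrow> linear_order_on (mons V) r \<and>
     (\<forall>m\<in>mons V. (0, m) \<in> r) \<and>
     (\<forall>a b. \<forall>c\<in>mons V. (a, b) \<in> r \<longrightarrow> (a + c, b + c) \<in> r)"

definition lead_mon :: "'v mon rel \<Rightarrow> ('v, 'k::zero) mpoly \<Rightarrow> 'v mon" where
  "lead_mon r p = (THE m. m \<in> keys p \<and> (\<forall>m'\<in>keys p. (m', m) \<in> r))"

definition initial_ideal ::
    "'v set \<Rightarrow> 'v mon rel \<Rightarrow> ('v, 'k::field) mpoly set \<Rightarrow> ('v, 'k) mpoly set" where
  "initial_ideal V r P = Idl\<^bsub>poly_ring V\<^esub> {monomial (lead_mon r p) | p. p \<in> P \<and> p \<noteq> 0}"

definition groebner_basis ::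
    "'v set \<Rightarrow> 'v mon rel \<Rightarrow> ('v, 'k::field) mpoly set \<Rightarrow> ('v, 'k) mpoly set \<Rightarrow> bool" where
  "groebner_basis V r I G \<longleftrightarrow>
     finite G \<and> G \<subseteq> I \<and> 0 \<notin> G \<and> initial_ideal V r G = initial_ideal V r I"

definition has_quadratic_GB :: "'v set \<Rightarrow> ('v, 'k::field) mpoly set \<Rightarrow> bool" where
  "has_quadratic_GB V I \<longleftrightarrow>
     (\<exists>r G. term_order V r \<and> groebner_basis V r I G \<and> (\<forall>g\<in>G. pdeg g = 2))"


section \<open>Macaulay's inverse system\<close>

definition partial :: "'v \<Rightarrow> ('v, 'k::field) mpoly \<Rightarrow> ('v, 'k) mpoly" where
  "partial v f = (\<Sum>m\<in>keys f.
     single (m - single v 1) (of_nat (lookup m v) * lookup f m))"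

definition diff_mon :: "'v mon \<Rightarrow> ('v, 'k::field) mpoly \<Rightarrow> ('v, 'k) mpoly" where
  "diff_mon m f = Finite_Set.fold (\<lambda>v. partial v ^^ lookup m v) f (keys m)"

definition diff_op :: "('v, 'k::field) mpoly \<Rightarrow> ('v, 'k) mpoly \<Rightarrow> ('v, 'k) mpoly" where
  "diff_op p f = (\<Sum>m\<in>keys p. single 0 (lookup p m) * diff_mon m f)"

definition Ann :: "'v set \<Rightarrow> ('v, 'k::field) mpoly \<Rightarrow> ('v, 'k) mpoly set" where
  "Ann V f = {p \<in> carrier (poly_ring V). diff_op p f = 0}"

text \<open>The fold in \<open>diff_mon\<close> is independent of the order of the variables because partial
  derivatives commute.\<close>

lemma lookup_partial:
  "lookup (partial v f) b = of_nat (Suc (lookup b v)) * lookup f (b + single v 1)"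
proof -
  let ?e = "single v (1::nat)"
  let ?t = "\<lambda>m. lookup (single (m - ?e) (of_nat (lookup m v) * lookup f m)) b"
  have z: "?t m = 0" if "m \<noteq> b + ?e" for m
  proof (cases "lookup m v = 0")
    case False
    then have "m - ?e + ?e = m"
      by (intro poly_mapping_eqI) (auto simp: lookup_add lookup_minus lookup_single when_def)
    then have "m - ?e \<noteq> b" using that by auto
    then show ?thesis by (simp add: lookup_single)
  qed simp
  have "lookup (partial v f) b = (\<Sum>m\<in>keys f. ?t m)"
    by (simp add: partial_def lookup_sum)
  also have "\<dots> = (\<Sum>m\<in>keys f \<union> {b + ?e}. ?t m)"
    by (rule sum.mono_neutral_left) (auto simp: in_keys_iff)
  also have "\<dots> = (\<Sum>m\<in>{b + ?e}. ?t m)"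
    using z by (intro sum.mono_neutral_right) auto
  finally show ?thesis by (simp add: lookup_add)
qed

lemma partial_commute: "partial u (partial v f) = partial v (partial u f)"
  by (intro poly_mapping_eqI)
    (auto simp: lookup_partial lookup_add lookup_single when_def algebra_simps)

lemma comp_fun_commute_partial_power:
  "comp_fun_commute (\<lambda>v. partial v ^^ k v :: ('v, 'k::field) mpoly \<Rightarrow> ('v, 'k) mpoly)"
proof -
  have c: "(partial u ^^ i) (partial v f) = partial v ((partial u ^^ i) f)"
    for u v :: 'v and i and f :: "('v, 'k) mpoly"
    by (induction i) (auto simp: partial_commute)
  have "(partial u ^^ i) ((partial v ^^ j) f) = (partial v ^^ j) ((partial u ^^ i) f)"
    for u v :: 'v and i j and f :: "('v, 'k) mpoly"
    by (induction j arbitrary: f) (simp_all add: c)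
  then show ?thesis by unfold_locales auto
qed


section \<open>Simplicial complexes on \<open>{1..n}\<close>\<close>

definition simplicial_complex :: "nat \<Rightarrow> nat set set \<Rightarrow> bool" where
  "simplicial_complex n \<Delta> \<longleftrightarrow>
     \<Delta> \<noteq> {} \<and> \<Delta> \<subseteq> Pow {1..n} \<and> (\<forall>F\<in>\<Delta>. \<forall>G. G \<subseteq> F \<longrightarrow> G \<in> \<Delta>)"

definition facets :: "nat set set \<Rightarrow> nat set set" where
  "facets \<Delta> = {F \<in> \<Delta>. \<forall>G\<in>\<Delta>. F \<subseteq> G \<longrightarrow> F = G}"

definition face_dim :: "nat set \<Rightarrow> int" where
  "face_dim F = int (card F) - 1"

definition complex_dim :: "nat set set \<Rightarrow> int" where
  "complex_dim \<Delta> = Max (face_dim ` \<Delta>)"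

definition pure :: "nat set set \<Rightarrow> bool" where
  "pure \<Delta> \<longleftrightarrow> (\<forall>F\<in>facets \<Delta>. \<forall>G\<in>facets \<Delta>. face_dim F = face_dim G)"

definition generated_complex :: "nat set set \<Rightarrow> nat set set" where
  "generated_complex \<F> = (\<Union>F\<in>\<F>. Pow F)"

text \<open>Lists are indexed from 0, so \<open>take i Fs\<close> consists of the facets preceding \<open>Fs ! i\<close>.\<close>

definition shellable :: "nat set set \<Rightarrow> bool" where
  "shellable \<Delta> \<longleftrightarrow> (\<exists>Fs. distinct Fs \<and> set Fs = facets \<Delta> \<and>
     (\<forall>i\<in>{1..<length Fs}.
        let \<Gamma> = generated_complex (set (take i Fs)) \<inter> generated_complex {Fs ! i}
        in pure \<Gamma> \<and> complex_dim \<Gamma> = complex_dim \<Delta> - 1))"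


section \<open>The ideals attached to a complex\<close>

text \<open>\<open>Z F\<close> is used only for facets \<open>F\<close>, and \<open>X i\<close>, \<open>Y i\<close> only for \<open>i \<in> {1..n}\<close>; the sets of
  variables below make these restrictions.\<close>

datatype pvar = X nat | Y nat | Z "nat set"

definition xprod :: "nat set \<Rightarrow> (pvar, 'k::field) mpoly" where
  "xprod F = (\<Prod>i\<in>F. var (X i))"

definition yprod :: "nat set \<Rightarrow> (pvar, 'k::field) mpoly" where
  "yprod F = (\<Prod>i\<in>F. var (Y i))"

definition x_vars :: "nat \<Rightarrow> pvar set" where
  "x_vars n = X ` {1..n}"

definition S_vars :: "nat \<Rightarrow> pvar set" where
  "S_vars n = X ` {1..n} \<union> Y ` {1..n}"

definition T_vars :: "nat \<Rightarrow> nat set set \<Rightarrow> pvar set" where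
  "T_vars n \<Delta> = S_vars n \<union> Z ` facets \<Delta>"

definition Q_vars :: "nat \<Rightarrow> nat set set \<Rightarrow> pvar set" where
  "Q_vars n \<Delta> = X ` {1..n} \<union> Z ` facets \<Delta>"

definition SR_ideal :: "nat \<Rightarrow> nat set set \<Rightarrow> (pvar, 'k::field) mpoly set" where
  "SR_ideal n \<Delta> = Idl\<^bsub>poly_ring (x_vars n)\<^esub> {xprod F | F. F \<subseteq> {1..n} \<and> F \<notin> \<Delta>}"

text \<open>The type argument is the coefficient field.\<close>

definition flag :: "'k::field itself \<Rightarrow> nat \<Rightarrow> nat set set \<Rightarrow> bool" where
  "flag K n \<Delta> \<longleftrightarrow> (\<exists>M. M \<subseteq> {m \<in> mons (x_vars n). mdeg m = 2} \<and>
     (SR_ideal n \<Delta> :: (pvar, 'k) mpoly set) = Idl\<^bsub>poly_ring (x_vars n)\<^esub> (monomial ` M))"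

definition Gamma_ideal :: "nat \<Rightarrow> nat set set \<Rightarrow> (pvar, 'k::field) mpoly set" where
  "Gamma_ideal n \<Delta> = Idl\<^bsub>poly_ring (S_vars n)\<^esub>
     (SR_ideal n \<Delta> \<union> {var (X i) * var (Y i) | i. i \<in> {1..n}})"

text \<open>The last set of generators generates the square of the ideal of all \<open>z\<^sub>F\<close>, so it
  contains the mixed products as well.\<close>

definition J_ideal :: "nat \<Rightarrow> nat set set \<Rightarrow> (pvar, 'k::field) mpoly set" where
  "J_ideal n \<Delta> = Idl\<^bsub>poly_ring (T_vars n \<Delta>)\<^esub>
     (Gamma_ideal n \<Delta>
      \<union> {var (X i) * var (Z F) | i F. i \<in> {1..n} \<and> F \<in> facets \<Delta> \<and> i \<notin> F}
      \<union> {yprod (F - G) * var (Z F) - yprod (G - F) * var (Z G) | F G.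
            F \<in> facets \<Delta> \<and> G \<in> facets \<Delta> \<and> F \<noteq> G}
      \<union> {var (Z F) * var (Z G) | F G. F \<in> facets \<Delta> \<and> G \<in> facets \<Delta>})"

definition f_poly :: "nat set set \<Rightarrow> (pvar, 'k::field) mpoly" where
  "f_poly \<Delta> = (\<Sum>F\<in>facets \<Delta>. var (Z F) * xprod F)"

text \<open>As in the literature, a property of the presented algebra \<open>R\<^sub>\<Delta>\<close> or \<open>A\<^sub>\<Delta>\<close> here means a
  property of the defining ideal in the given presentation.\<close>

definition R_has_quadratic_GB :: "'k::field itself \<Rightarrow> nat \<Rightarrow> nat set set \<Rightarrow> bool" where
  "R_has_quadratic_GB K n \<Delta> \<longleftrightarrow>
     has_quadratic_GB (T_vars n \<Delta>) (J_ideal n \<Delta> :: (pvar, 'k) mpoly set)"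

definition A_has_quadratic_GB :: "'k::field itself \<Rightarrow> nat \<Rightarrow> nat set set \<Rightarrow> bool" where
  "A_has_quadratic_GB K n \<Delta> \<longleftrightarrow>
     has_quadratic_GB (Q_vars n \<Delta>) (Ann (Q_vars n \<Delta>) (f_poly \<Delta> :: (pvar, 'k) mpoly))"

end

theory Submission
  imports Defs
begin

text \<open>
Both ideals are spanned by monomials together with differences of two monomials, and both describe
the facets in the same way; the theorem is a statement about such ideals.

For \<open>A\<^sub>\<Delta>\<close> say that a monomial \<open>b\<close> detects \<open>m\<close> if \<open>b m\<close> is one of the monomials \<open>x\<^sup>F z\<^sub>F\<close> of the
facet polynomial. That polynomial is squarefree with coefficients 1, so differentiation merely
subtracts exponents, and an operator annihilates it iff for each \<open>b\<close> the coefficients of the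
monomials detected by \<open>b\<close> add up to 0. For \<open>R\<^sub>\<Delta>\<close> the same holds with other detectors:
\<open>z\<^sub>F \<mapsto> y\<^bsup>[n] - F\<^esup>\<close> embeds the canonical module into the face ring of \<open>\<Gamma>\<close>, and a monomial of degree
at most 1 in the \<open>z\<^sub>F\<close> is detected by its image, if nonzero, in one of two copies of the face ring,
one for each degree. So each ideal is spanned by the undetected monomials and the differences
\<open>m - m'\<close> of monomials with a common detector.

Hence, for every term order, \<open>m\<close> lies in the initial ideal iff it is undetected or some smaller
\<open>m'\<close> shares a detector with it (\<open>reducible\<close>), and the Groebner basis can be chosen quadratic iff
every such monomial is divisible by one of degree 2 (\<open>quadratic_GB_detector_kernel_iff\<close>). The undetected
monomials are no obstacle: because \<open>\<Delta>\<close> is flag they are generated in degree 2. With \<open>w = x\<close> for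
\<open>A\<^sub>\<Delta>\<close> and \<open>w = y\<close> for \<open>R\<^sub>\<Delta>\<close>, the pairs with a common detector are multiples of the exchange pairs
\<open>w\<^bsup>F - G\<^esup> z\<^sub>F\<close>, \<open>w\<^bsup>G - F\<^esup> z\<^sub>G\<close>. Multiplying by \<open>w\<^bsup>F \<inter> G\<^esup>\<close> compares the two by their keys \<open>w\<^sup>F z\<^sub>F\<close> and
\<open>w\<^sup>G z\<^sub>G\<close>, so a term order matters only through the linear order of the facets by their keys, and
every linear order of the facets arises in this way. A monomial \<open>w\<^bsup>F - G\<^esup> z\<^sub>F\<close> with \<open>G\<close> before \<open>F\<close> is
divisible by a reducible quadric iff there is \<open>H\<close> before \<open>F\<close> with \<open>F - H = {i}\<close> and \<open>i \<in> F - G\<close>: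
the quadric is then \<open>w\<^sub>i z\<^sub>F\<close>. This exchange condition (\<open>exchange_ordered\<close>) says exactly that the
order is a shelling (\<open>shellable_iff_exchange_order\<close>), which does not depend on the ideal.
\<close>

section \<open>Monomials and monomial ideals\<close>

lemma keys_add_nat: "keys (a + b :: 'v mon) = keys a \<union> keys b"
  by (auto simp: in_keys_iff lookup_add)

lemma mons_add_iff: "a + b \<in> mons V \<longleftrightarrow> a \<in> mons V \<and> b \<in> mons V"
  by (auto simp: mons_def keys_add_nat)

lemma single_mons_iff [simp]: "single v (k::nat) \<in> mons V \<longleftrightarrow> k = 0 \<or> v \<in> V"
  by (cases "k = 0") (simp_all add: mons_def)

lemma mdeg_superset:
  assumes "finite U" "keys m \<subseteq> U"
  shows "mdeg m = (\<Sum>v\<in>U. lookup m v)"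
  unfolding mdeg_def by (rule sum.mono_neutral_left) (use assms in \<open>auto simp: in_keys_iff\<close>)

lemma mdeg_add: "mdeg (a + b) = mdeg a + mdeg b"
  by (simp add: mdeg_superset[of "keys a \<union> keys b"] keys_add_nat lookup_add sum.distrib)

lemma mdeg_single [simp]: "mdeg (single v k) = k"
  by (simp add: mdeg_def)

lemma mdeg_0 [simp]: "mdeg 0 = 0"
  by (simp add: mdeg_def)

lemma mdeg_eq_0_iff: "mdeg m = 0 \<longleftrightarrow> m = 0"
proof
  assume "mdeg m = 0"
  then have "lookup m v = 0" for v by (cases "v \<in> keys m") (auto simp: mdeg_def in_keys_iff)
  then show "m = 0" by (intro poly_mapping_eqI) simp
qed simp

lemma mon_cancel:
  assumes "\<And>v. lookup l v \<le> lookup m v"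
  shows "m = l + (m - l :: 'v mon)"
  using assms by (intro poly_mapping_eqI) (simp add: lookup_add lookup_minus)

lemma mon_split_var:
  assumes "v \<in> keys m"
  shows "m = single v 1 + (m - single v 1 :: 'v mon)"
  using assms by (intro mon_cancel) (auto simp: lookup_single when_def in_keys_iff)

lemma mdeg_SucE:
  assumes "mdeg m = Suc k"
  obtains v m' where "m = single v 1 + m'" "mdeg m' = k"
proof -
  from assms obtain v where "v \<in> keys m"
    by (metis mdeg_def nat.distinct(1) sum.empty ex_in_conv)
  from mon_split_var[OF this] assms have "m = single v 1 + (m - single v 1)"
    "mdeg (m - single v 1) = k"
    by (metis, metis mdeg_add mdeg_single add_left_cancel plus_1_eq_Suc)
  then show ?thesis using that by blast
qed

lemma mdeg_1E:
  assumes "mdeg m = 1" obtains v where "m = single v 1"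
  using assms mdeg_SucE[of m 0] by (metis One_nat_def mdeg_eq_0_iff add.right_neutral)

lemma mdeg_2E:
  assumes "mdeg m = 2" obtains u v where "m = single u 1 + single v 1"
  using assms mdeg_SucE[of m 1] by (metis mdeg_1E numeral_2_eq_2 One_nat_def)

lemma finite_mons_mdeg_2:
  assumes "finite V" shows "finite {m \<in> mons V. mdeg m = 2}"
proof -
  have "{m \<in> mons V. mdeg m = 2} \<subseteq> (\<lambda>(u, v). single u 1 + single v 1) ` (V \<times> V)"
  proof
    fix m assume "m \<in> {m \<in> mons V. mdeg m = 2}"
    then obtain u v where "m = single u 1 + single v 1" "m \<in> mons V" by (auto elim: mdeg_2E)
    then show "m \<in> (\<lambda>(u, v). single u 1 + single v 1) ` (V \<times> V)"
      by (auto simp: mons_add_iff intro!: image_eqI[of _ _ "(u, v)"])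
  qed
  then show ?thesis using assms finite_subset by blast
qed

lemma sum_single_lookup: "(\<Sum>k\<in>keys p. single k (lookup p k)) = p"
  by (intro poly_mapping_eqI)
    (auto simp: lookup_sum lookup_single when_def in_keys_iff)

lemma carrier_iff: "p \<in> carrier (poly_ring V) \<longleftrightarrow> keys p \<subseteq> mons V"
  by (simp add: poly_ring_def)

lemma monomial_carrier_iff [simp]:
  "(monomial m :: ('v, 'k::comm_ring_1) mpoly) \<in> carrier (poly_ring V) \<longleftrightarrow> m \<in> mons V"
  by (simp add: carrier_iff monomial_def)

lemma keys_monomial [simp]: "keys (monomial m :: ('v, 'k::zero_neq_one) mpoly) = {m}"
  by (simp add: monomial_def)

lemma monomial_mult: "monomial a * monomial b = (monomial (a + b) :: ('v, 'k::comm_ring_1) mpoly)"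
  by (simp add: monomial_def mult_single)

lemma poly_ring_simps [simp]:
  "x \<otimes>\<^bsub>poly_ring V\<^esub> y = x * y" "x \<oplus>\<^bsub>poly_ring V\<^esub> y = x + y"
  "\<one>\<^bsub>poly_ring V\<^esub> = 1" "\<zero>\<^bsub>poly_ring V\<^esub> = 0"
  by (simp_all add: poly_ring_def)

lemma ring_poly_ring: "ring (poly_ring V :: ('v, 'k::comm_ring_1) mpoly ring)"
  using cring_poly_ring cring.axioms(1) by blast

lemma ideal_poly_ringI:
  fixes I :: "('v, 'k::comm_ring_1) mpoly set"
  assumes "I \<subseteq> carrier (poly_ring V)" "0 \<in> I" "\<And>a b. a \<in> I \<Longrightarrow> b \<in> I \<Longrightarrow> a + b \<in> I"
    and mult: "\<And>a x. a \<in> I \<Longrightarrow> x \<in> carrier (poly_ring V) \<Longrightarrow> x * a \<in> I"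
  shows "ideal I (poly_ring V)"
proof (rule idealI[OF ring_poly_ring])
  interpret R: cring "poly_ring V :: ('v, 'k) mpoly ring" by (rule cring_poly_ring)
  have "- a \<in> I" if "a \<in> I" for a
    using mult[OF that, of "- 1"] by (simp add: carrier_iff mons_zero)
  moreover have "\<ominus>\<^bsub>poly_ring V\<^esub> a = - a" if "a \<in> I" for a
    by (rule R.minus_equality) (use that \<open>\<And>a. a \<in> I \<Longrightarrow> - a \<in> I\<close> assms(1) in auto)
  ultimately show "subgroup I (add_monoid (poly_ring V))"
    using assms by (intro R.add.subgroupI) (auto simp: a_inv_def)
qed (use mult in \<open>auto simp: mult.commute\<close>)

lemma ideal_poly_ringD:
  fixes I :: "('v, 'k::comm_ring_1) mpoly set"
  assumes "ideal I (poly_ring V)"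
  shows "I \<subseteq> carrier (poly_ring V)" "0 \<in> I" "a \<in> I \<Longrightarrow> b \<in> I \<Longrightarrow> a + b \<in> I"
    "a \<in> I \<Longrightarrow> x \<in> carrier (poly_ring V) \<Longrightarrow> x * a \<in> I"
proof -
  interpret ideal I "poly_ring V" by fact
  show "I \<subseteq> carrier (poly_ring V)" "0 \<in> I"
    using a_subset additive_subgroup.zero_closed[OF is_additive_subgroup] by auto
  show "a + b \<in> I" if "a \<in> I" "b \<in> I" using additive_subgroup.a_closed[OF is_additive_subgroup that] by simp
  show "x * a \<in> I" if "a \<in> I" "x \<in> carrier (poly_ring V)" using I_l_closed[OF that] by simp
qed


text \<open>A polynomial is built from its terms one at a time, so a set closed under addition is
  closed under multiplication by polynomials as soon as it is under multiplication by terms.\<close>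

lemma mult_closed_if_term_mult_closed:
  fixes I :: "('v, 'k::comm_ring_1) mpoly set"
  assumes "0 \<in> I" and add: "\<And>a b. a \<in> I \<Longrightarrow> b \<in> I \<Longrightarrow> a + b \<in> I"
    and mult: "\<And>c k. c \<in> mons V \<Longrightarrow> single c k * a \<in> I"
    and x: "x \<in> carrier (poly_ring V)"
  shows "x * a \<in> I"
proof -
  have "(\<Sum>c\<in>K. single c (lookup x c) * a) \<in> I" if "finite K" "K \<subseteq> mons V" for K
    using that by induction (auto intro!: assms)
  from this[of "keys x"] have "(\<Sum>c\<in>keys x. single c (lookup x c)) * a \<in> I"
    using x by (simp add: carrier_iff sum_distrib_right)
  then show ?thesis by (simp add: sum_single_lookup)
qed

lemma carrier_mono:
  assumes "V \<subseteq> W"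
  shows "carrier (poly_ring V) \<subseteq> (carrier (poly_ring W) :: ('v, 'k::comm_ring_1) mpoly set)"
  using assms by (fastforce simp: carrier_iff mons_def)

text \<open>The three nested ideals of the presentation are generated in polynomial rings over growing sets of
variables, so an inclusion has to be transferred from a larger ring to a smaller one: an ideal of
the larger ring meets the smaller ring in an ideal.\<close>

lemma genideal_mono_ring:
  fixes A :: "('v, 'k::comm_ring_1) mpoly set"
  assumes "V \<subseteq> W" "A \<subseteq> carrier (poly_ring V)" "A \<subseteq> I" "ideal I (poly_ring W)"
  shows "Idl\<^bsub>poly_ring V\<^esub> A \<subseteq> I"
proof -
  note sub = carrier_mono[OF assms(1)]
  note I = ideal_poly_ringD[OF assms(4)]
  have "ideal (I \<inter> carrier (poly_ring V)) (poly_ring V)"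
  proof (rule ideal_poly_ringI)
    interpret R: cring "poly_ring V :: ('v, 'k) mpoly ring" by (rule cring_poly_ring)
    show "a + b \<in> I \<inter> carrier (poly_ring V)"
      if "a \<in> I \<inter> carrier (poly_ring V)" "b \<in> I \<inter> carrier (poly_ring V)" for a b
      using that I R.a_closed[of a b] by auto
    show "x * a \<in> I \<inter> carrier (poly_ring V)"
      if "a \<in> I \<inter> carrier (poly_ring V)" "x \<in> carrier (poly_ring V)" for a x
      using that I sub R.m_closed[of x a] by auto
  qed (use I in \<open>auto simp: carrier_iff\<close>)
  from ring.genideal_minimal[OF ring_poly_ring this, of A] assms show ?thesis by auto
qed

lemma genideal_monomials:
  assumes "L \<subseteq> mons V"
  shows "Idl\<^bsub>poly_ring V\<^esub> (monomial ` L :: ('v, 'k::comm_ring_1) mpoly set) =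
    {p \<in> carrier (poly_ring V). \<forall>m\<in>keys p. \<exists>l\<in>L. \<exists>c. m = l + c}" (is "?I = ?J")
proof
  have "ideal ?J (poly_ring V)"
  proof (rule ideal_poly_ringI)
    interpret R: cring "poly_ring V :: ('v, 'k) mpoly ring" by (rule cring_poly_ring)
    show "a + b \<in> ?J" if "a \<in> ?J" "b \<in> ?J" for a b
      using that R.a_closed[of a b] Poly_Mapping.keys_add[of a b] by auto
    show "x * a \<in> ?J" if "a \<in> ?J" "x \<in> carrier (poly_ring V)" for a x
    proof -
      have "\<exists>l\<in>L. \<exists>c. m = l + c" if "m \<in> keys (x * a)" for m
      proof -
        from that Poly_Mapping.keys_mult[of x a] obtain u v where "u \<in> keys x" "v \<in> keys a" "m = u + v"
          by blast
        moreover from this \<open>a \<in> ?J\<close> obtain l c where "l \<in> L" "v = l + c" by blast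
        ultimately have "l \<in> L" "m = l + (u + c)" by (auto simp: ac_simps)
        then show ?thesis by blast
      qed
      then show ?thesis using that R.m_closed[of x a] by auto
    qed
  qed (auto simp: carrier_iff)
  moreover have "monomial ` L \<subseteq> ?J"
    using assms by (auto intro!: exI[of _ 0])
  ultimately show "?I \<subseteq> ?J" by (rule ring.genideal_minimal[OF ring_poly_ring])
next
  have "monomial ` L \<subseteq> (carrier (poly_ring V) :: ('v, 'k) mpoly set)" using assms by auto
  note I = ideal_poly_ringD[OF ring.genideal_ideal[OF ring_poly_ring this]]
    and self = ring.genideal_self[OF ring_poly_ring this]
  show "?J \<subseteq> ?I"
  proof
    fix p assume p: "p \<in> ?J"
    have "single m k \<in> ?I" if "m \<in> keys p" for m k
    proof -
      from that p have m: "m \<in> mons V" by (auto simp: carrier_iff)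
      from that p obtain l c where lc: "l \<in> L" "m = l + c" by blast
      with m have c: "c \<in> mons V" by (simp add: mons_add_iff)
      have "single c k * monomial l \<in> ?I"
        by (rule I(4)) (use lc c self in \<open>auto simp: carrier_iff\<close>)
      then show ?thesis by (simp add: monomial_def mult_single lc add.commute)
    qed
    note terms = this
    have "(\<Sum>m\<in>K. single m (lookup p m)) \<in> ?I" if "finite K" "K \<subseteq> keys p" for K
      using that by induction (auto intro!: I terms)
    from this[of "keys p"] show "p \<in> ?I" by (simp add: sum_single_lookup)
  qed
qed

lemma monomial_in_genideal_monomials:
  assumes "L \<subseteq> mons V" "m \<in> mons V"
  shows "(monomial m :: ('v, 'k::comm_ring_1) mpoly) \<in> Idl\<^bsub>poly_ring V\<^esub> (monomial ` L) \<longleftrightarrow>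
    (\<exists>l\<in>L. \<exists>c. m = l + c)"
  using assms by (simp add: genideal_monomials)


section \<open>Term orders\<close>

lemma term_orderD:
  assumes "term_order V r"
  shows "(a, b) \<in> r \<Longrightarrow> a \<in> mons V \<and> b \<in> mons V"
    and "a \<in> mons V \<Longrightarrow> (a, a) \<in> r"
    and "(a, b) \<in> r \<Longrightarrow> (b, c) \<in> r \<Longrightarrow> (a, c) \<in> r"
    and "(a, b) \<in> r \<Longrightarrow> (b, a) \<in> r \<Longrightarrow> a = b"
    and "a \<in> mons V \<Longrightarrow> b \<in> mons V \<Longrightarrow> (a, b) \<in> r \<or> (b, a) \<in> r"
    and "(a, b) \<in> r \<Longrightarrow> c \<in> mons V \<Longrightarrow> (a + c, b + c) \<in> r"
proof -
  have r: "r \<subseteq> mons V \<times> mons V" "refl_on (mons V) r" "trans r" "antisym r" "total_on (mons V) r"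
    and add: "\<forall>a b. \<forall>c\<in>mons V. (a, b) \<in> r \<longrightarrow> (a + c, b + c) \<in> r"
    using assms by (simp_all add: term_order_def order_on_defs)
  show "(a, b) \<in> r \<Longrightarrow> a \<in> mons V \<and> b \<in> mons V" using r(1) by blast
  show refl: "a \<in> mons V \<Longrightarrow> (a, a) \<in> r" for a using refl_onD[OF r(2)] .
  show "(a, b) \<in> r \<Longrightarrow> (b, c) \<in> r \<Longrightarrow> (a, c) \<in> r" using transD[OF r(3)] .
  show "(a, b) \<in> r \<Longrightarrow> (b, a) \<in> r \<Longrightarrow> a = b" using antisymD[OF r(4)] .
  show "a \<in> mons V \<Longrightarrow> b \<in> mons V \<Longrightarrow> (a, b) \<in> r \<or> (b, a) \<in> r"
    using r(5) refl[of a] by (cases "a = b") (simp_all add: total_on_def)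
  show "(a, b) \<in> r \<Longrightarrow> c \<in> mons V \<Longrightarrow> (a + c, b + c) \<in> r" using add by simp
qed

lemma term_order_cancel:
  assumes "term_order V r" "(a + c, b + c) \<in> r"
  shows "(a, b) \<in> r"
proof (rule ccontr)
  note r = term_orderD[OF assms(1)]
  assume n: "(a, b) \<notin> r"
  have m: "a \<in> mons V" "b \<in> mons V" "c \<in> mons V"
    using r(1)[OF assms(2)] by (simp_all add: mons_add_iff)
  then have "(b, a) \<in> r" using n r(5) by blast
  then have "a + c = b + c" using r(4)[OF assms(2)] r(6) m by blast
  then show False using n r(2) m by simp
qed

lemma term_order_max:
  assumes r: "term_order V r" and K: "finite K" "K \<noteq> {}" "K \<subseteq> mons V"
  shows "\<exists>m\<in>K. \<forall>m'\<in>K. (m', m) \<in> r"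
  using K
proof (induction rule: finite_ne_induct)
  case (singleton x)
  then show ?case using term_orderD(2)[OF r] by auto
next
  case (insert x K)
  then obtain m where m: "m \<in> K" "\<forall>m'\<in>K. (m', m) \<in> r" by auto
  show ?case
  proof (cases "(x, m) \<in> r")
    case False
    then have "(m, x) \<in> r" using term_orderD(5)[OF r, of x m] m insert.prems by auto
    then have "\<forall>m'\<in>insert x K. (m', x) \<in> r"
      using m term_orderD(2)[OF r, of x] term_orderD(3)[OF r] insert.prems by blast
    then show ?thesis by blast
  qed (use m in auto)
qed

lemma lead_mon_eqI:
  assumes "term_order V r" "m \<in> keys p" "\<And>m'. m' \<in> keys p \<Longrightarrow> (m', m) \<in> r"
  shows "lead_mon r p = m"
  unfolding lead_mon_def
  by (rule the_equality) (use assms(2,3) term_orderD(4)[OF assms(1)] in \<open>simp, blast\<close>)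

lemma lead_mon_props:
  assumes r: "term_order V r" and "p \<in> carrier (poly_ring V)" "p \<noteq> 0"
  shows "lead_mon r p \<in> keys p" "m \<in> keys p \<Longrightarrow> (m, lead_mon r p) \<in> r"
proof -
  obtain m0 where m0: "m0 \<in> keys p" "\<forall>m'\<in>keys p. (m', m0) \<in> r"
    using term_order_max[OF r, of "keys p"] assms by (auto simp: carrier_iff)
  then have "lead_mon r p = m0" using lead_mon_eqI[OF r] by blast
  with m0 show "lead_mon r p \<in> keys p" "m \<in> keys p \<Longrightarrow> (m, lead_mon r p) \<in> r" by auto
qed


text \<open>The lexicographic order in which variables of larger rank dominate.\<close>

definition lex_order :: "'v set \<Rightarrow> ('v \<Rightarrow> nat) \<Rightarrow> 'v mon rel" where
  "lex_order V \<rho> = {(a, b). a \<in> mons V \<and> b \<in> mons V \<and>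
     (a = b \<or> (\<exists>v\<in>V. lookup a v < lookup b v \<and> (\<forall>u\<in>V. \<rho> u > \<rho> v \<longrightarrow> lookup a u = lookup b u)))}"

text \<open>Two distinct monomials are compared at the variable of largest rank at which they differ.\<close>

lemma term_order_lex_order:
  assumes "finite V" "inj_on \<rho> V"
  shows "term_order V (lex_order V \<rho>)"
proof -
  define less where "less a b \<longleftrightarrow> (\<exists>v\<in>V. lookup a v < lookup b v \<and>
    (\<forall>u\<in>V. \<rho> u > \<rho> v \<longrightarrow> lookup a u = lookup b u))" for a b :: "'a mon"
  have r: "(a, b) \<in> lex_order V \<rho> \<longleftrightarrow> a \<in> mons V \<and> b \<in> mons V \<and> (a = b \<or> less a b)" for a b
    by (simp add: lex_order_def less_def)
  have lin: "\<rho> u < \<rho> v \<or> \<rho> v < \<rho> u \<or> u = v" if "u \<in> V" "v \<in> V" for u v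
    using assms(2) that by (meson inj_onD linorder_less_linear)
  have trans: "less a c" if "less a b" "less b c" for a b c
  proof -
    from that obtain u v where u: "u \<in> V" "lookup a u < lookup b u" "\<forall>w\<in>V. \<rho> w > \<rho> u \<longrightarrow> lookup a w = lookup b w"
      and v: "v \<in> V" "lookup b v < lookup c v" "\<forall>w\<in>V. \<rho> w > \<rho> v \<longrightarrow> lookup b w = lookup c w"
      unfolding less_def by blast
    consider "\<rho> u < \<rho> v" | "\<rho> v < \<rho> u" | "u = v" using lin u v by blast
    then show ?thesis
    proof cases
      case 1 then show ?thesis unfolding less_def using u v by (intro bexI[of _ v]) auto
    next
      case 2 then show ?thesis unfolding less_def using u v by (intro bexI[of _ u]) auto
    next
      case 3 then show ?thesis unfolding less_def using u v by (intro bexI[of _ v]) auto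
    qed
  qed
  have irrefl: "\<not> less a a" for a by (simp add: less_def)
  have total: "less a b \<or> less b a" if "a \<in> mons V" "b \<in> mons V" "a \<noteq> b" for a b
  proof -
    let ?D = "{v\<in>V. lookup a v \<noteq> lookup b v}"
    have "?D \<noteq> {}"
    proof
      assume "?D = {}"
      then have "lookup a v = lookup b v" for v
      proof (cases "v \<in> V")
        case False
        then have "v \<notin> keys a" "v \<notin> keys b" using that by (auto simp: mons_def)
        then show ?thesis by (simp add: in_keys_iff)
      qed (use \<open>?D = {}\<close> in auto)
      then show False using \<open>a \<noteq> b\<close> poly_mapping_eqI by blast
    qed
    then have "Max (\<rho> ` ?D) \<in> \<rho> ` ?D" using assms(1) by (intro Max_in) auto
    then obtain v where v: "v \<in> ?D" "\<rho> v = Max (\<rho> ` ?D)" by auto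
    have max: "\<rho> u \<le> \<rho> v" if "u \<in> ?D" for u
      unfolding v(2) using that assms(1) by (intro Max_ge) auto
    then have above: "lookup a u = lookup b u" if "u \<in> V" "\<rho> u > \<rho> v" for u
      using max[of u] that by fastforce
    have "lookup a v < lookup b v \<or> lookup b v < lookup a v" using v(1) by auto
    then show ?thesis
    proof
      assume "lookup a v < lookup b v"
      then have "less a b" unfolding less_def using v(1) above by (intro bexI[of _ v]) auto
      then show ?thesis ..
    next
      assume "lookup b v < lookup a v"
      then have "less b a" unfolding less_def using v(1) above by (intro bexI[of _ v]) auto
      then show ?thesis ..
    qed
  qed
  have zero: "less 0 m" if "m \<in> mons V" "m \<noteq> 0" for m
    using total[of 0 m] that by (auto simp: less_def mons_zero)
  have add: "less (a + c) (b + c)" if "less a b" for a b c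
    using that by (simp add: less_def lookup_add)
  show ?thesis
    unfolding term_order_def order_on_defs
  proof (intro conjI)
    show "lex_order V \<rho> \<subseteq> mons V \<times> mons V" "refl_on (mons V) (lex_order V \<rho>)"
      by (auto simp: r intro!: refl_onI)
    show "trans (lex_order V \<rho>)" by (rule transI) (unfold r, metis trans)
    show "antisym (lex_order V \<rho>)" by (rule antisymI) (unfold r, metis trans irrefl)
    show "total_on (mons V) (lex_order V \<rho>)" by (rule total_onI) (unfold r, metis total)
    show "\<forall>m\<in>mons V. (0, m) \<in> lex_order V \<rho>" unfolding r using zero mons_zero by metis
    show "\<forall>a b. \<forall>c\<in>mons V. (a, b) \<in> lex_order V \<rho> \<longrightarrow> (a + c, b + c) \<in> lex_order V \<rho>"
      unfolding r by (metis add mons_add_iff)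
  qed
qed


section \<open>Initial ideals of kernels of detectors\<close>

definition detected_sum :: "('b \<Rightarrow> 'v mon \<Rightarrow> bool) \<Rightarrow> 'b \<Rightarrow> ('v, 'k::field) mpoly \<Rightarrow> 'k" where
  "detected_sum D b p = (\<Sum>m\<in>keys p. if D b m then lookup p m else 0)"

text \<open>An element \<open>b\<close> detects the monomials \<open>m\<close> with \<open>D b m\<close>, and the kernel consists of the polynomials
whose coefficients cancel within every detected set. If two detected sets are equal or disjoint
(\<open>coherent\<close>), this is the kernel of a linear map that sends each monomial either to 0 or to a
basis vector named by the set detecting it.\<close>

definition detector_kernel :: "'v set \<Rightarrow> ('b \<Rightarrow> 'v mon \<Rightarrow> bool) \<Rightarrow> ('v, 'k::field) mpoly set" where
  "detector_kernel V D = {p \<in> carrier (poly_ring V). \<forall>b. detected_sum D b p = 0}"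

definition coherent :: "'v set \<Rightarrow> ('b \<Rightarrow> 'v mon \<Rightarrow> bool) \<Rightarrow> bool" where
  "coherent V D \<longleftrightarrow> (\<forall>m\<in>mons V. \<forall>m'\<in>mons V. \<forall>b b'. D b m \<longrightarrow> D b m' \<longrightarrow> D b' m \<longrightarrow> D b' m')"

text \<open>The exponents of the initial ideal of the kernel, for the term order \<open>r\<close>: a detected monomial
leads a binomial as soon as it is not the least one in its class.\<close>

definition reducible :: "'v set \<Rightarrow> ('b \<Rightarrow> 'v mon \<Rightarrow> bool) \<Rightarrow> 'v mon rel \<Rightarrow> 'v mon \<Rightarrow> bool" where
  "reducible V D r m \<longleftrightarrow> m \<in> mons V \<and>
     ((\<forall>b. \<not> D b m) \<or> (\<exists>m'\<in>mons V. \<exists>b. m' \<noteq> m \<and> D b m \<and> D b m' \<and> (m', m) \<in> r))"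

lemma coherentD:
  assumes "coherent V D" "m \<in> mons V" "m' \<in> mons V" "D b m" "D b m'"
  shows "D b' m \<longleftrightarrow> D b' m'"
  using assms unfolding coherent_def by blast

lemma detected_sum_superset:
  assumes "finite U" "keys p \<subseteq> U"
  shows "detected_sum D b p = (\<Sum>m\<in>U. if D b m then lookup p m else 0)"
  unfolding detected_sum_def
  by (rule sum.mono_neutral_left) (use assms in \<open>auto simp: in_keys_iff\<close>)

lemma detected_sum_0 [simp]: "detected_sum D b 0 = 0"
  by (simp add: detected_sum_def)

lemma detected_sum_add: "detected_sum D b (p + q) = detected_sum D b p + detected_sum D b q"
  using Poly_Mapping.keys_add[of p q]
  by (simp add: detected_sum_superset[of "keys p \<union> keys q"] lookup_add flip: sum.distrib)
    (intro sum.cong, auto simp: lookup_add)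

lemma detected_sum_uminus: "detected_sum D b (- p) = - detected_sum D b p"
  by (simp add: detected_sum_def flip: sum_negf) (intro sum.cong, auto)

lemma detected_sum_single: "detected_sum D b (single m k) = (if D b m then k else 0)"
  by (simp add: detected_sum_superset[of "{m}"])

lemma detector_kernel_carrier: "detector_kernel V D \<subseteq> carrier (poly_ring V)"
  by (auto simp: detector_kernel_def)

lemma detector_kernel_0: "0 \<in> detector_kernel V D"
  by (auto simp: detector_kernel_def carrier_iff)

lemma detector_kernel_add:
  assumes "p \<in> detector_kernel V D" "q \<in> detector_kernel V D"
  shows "p + q \<in> detector_kernel V D"
  using assms Poly_Mapping.keys_add[of p q]
  by (auto simp: detector_kernel_def carrier_iff detected_sum_add)

lemma detector_kernel_minus:
  assumes "p \<in> detector_kernel V D" "q \<in> detector_kernel V D"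
  shows "p - q \<in> detector_kernel V D"
  using detector_kernel_add[of p V D "- q"] assms
  by (auto simp: detector_kernel_def carrier_iff detected_sum_uminus)

lemma single_in_detector_kernel:
  assumes "m \<in> mons V" "\<And>b. \<not> D b m"
  shows "single m k \<in> detector_kernel V D"
  using assms by (auto simp: detector_kernel_def carrier_iff detected_sum_single)

lemma binomial_in_detector_kernel:
  assumes "m \<in> mons V" "m' \<in> mons V" "\<And>b. D b m \<longleftrightarrow> D b m'"
  shows "single m k - single m' k \<in> detector_kernel V D"
proof -
  have "keys (single m k - single m' k) \<subseteq> {m, m'}"
    by (auto simp: in_keys_iff lookup_minus lookup_single when_def split: if_splits)
  moreover have "detected_sum D b (single m k - single m' k) = 0" for b
    using assms(3) detected_sum_add[of D b "single m k" "- single m' k"]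
    by (simp add: detected_sum_uminus detected_sum_single)
  ultimately show ?thesis using assms(1,2) by (auto simp: detector_kernel_def carrier_iff)
qed

text \<open>A sum of coefficients over a detected set cannot vanish if exactly one of them is nonzero.\<close>

lemma detector_kernel_partner:
  assumes "p \<in> detector_kernel V D" "m \<in> keys p" "D b m"
  shows "\<exists>m'\<in>keys p. m' \<noteq> m \<and> D b m'"
proof (rule ccontr)
  assume "\<not> ?thesis"
  then have "(if D b m' then lookup p m' else 0) = (if m' = m then lookup p m else 0)"
    if "m' \<in> keys p" for m'
    using that assms(3) by auto
  then have "detected_sum D b p = lookup p m"
    using assms(2) by (simp add: detected_sum_def)
  then show False using assms by (auto simp: detector_kernel_def in_keys_iff)
qed

text \<open>The kernel is spanned by the undetected monomials and the binomials with a common detector: each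
step removes one monomial from the support, by moving its coefficient to a partner if it has one.\<close>

lemma detector_kernel_induct [consumes 2, case_names zero monom binom]:
  fixes p :: "('v, 'k::field) mpoly"
  assumes "p \<in> detector_kernel V D" "coherent V D" "P 0"
    and monom: "\<And>q m k. P q \<Longrightarrow> m \<in> mons V \<Longrightarrow> (\<And>b. \<not> D b m) \<Longrightarrow> P (q + single m k)"
    and binom: "\<And>q m m' b k. P q \<Longrightarrow> m \<in> mons V \<Longrightarrow> m' \<in> mons V \<Longrightarrow> m \<noteq> m' \<Longrightarrow>
      D b m \<Longrightarrow> D b m' \<Longrightarrow> P (q + (single m k - single m' k))"
  shows "P p"
  using assms(1)
proof (induction "card (keys p)" arbitrary: p rule: less_induct)
  case less
  show ?case
  proof (cases "p = 0")
    case False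
    then obtain m where m: "m \<in> keys p" by (metis ex_in_conv keys_eq_empty)
    have keys_mons: "keys p \<subseteq> mons V" using less.prems by (simp add: detector_kernel_def carrier_iff)
    have smaller: "card (keys (p - t)) < card (keys p)"
      if "lookup t m = lookup p m" "keys t \<subseteq> keys p" for t
    proof (rule psubset_card_mono)
      have "m \<notin> keys (p - t)" using that by (simp add: in_keys_iff lookup_minus)
      moreover have "keys (p - t) \<subseteq> keys p"
        using that(2) keys_diff[of p t] by blast
      ultimately show "keys (p - t) \<subset> keys p" using m by blast
    qed simp
    show ?thesis
    proof (cases "\<exists>b. D b m")
      case True
      then obtain b where b: "D b m" by blast
      obtain m' where m': "m' \<in> keys p" "m' \<noteq> m" "D b m'"
        using detector_kernel_partner[OF less.prems m b] by blast
      let ?t = "single m (lookup p m) - single m' (lookup p m)"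
      have "?t \<in> detector_kernel V D"
        by (rule binomial_in_detector_kernel; (rule coherentD[OF assms(2) _ _ b m'(3)])?)
          (use m m' keys_mons in blast)+
      then have "p - ?t \<in> detector_kernel V D" by (rule detector_kernel_minus[OF less.prems])
      moreover have "card (keys (p - ?t)) < card (keys p)"
        using m m' keys_diff[of "single m (lookup p m)" "single m' (lookup p m)"]
        by (intro smaller) (auto simp: lookup_minus lookup_single_not_eq split: if_splits)
      ultimately have "P (p - ?t)" using less.hyps by blast
      then have "P (p - ?t + ?t)"
        by (rule binom) (use m m' b keys_mons in blast)+
      then show ?thesis by simp
    next
      case False
      let ?t = "single m (lookup p m)"
      have "?t \<in> detector_kernel V D"
        by (rule single_in_detector_kernel) (use False m keys_mons in blast)+
      then have "p - ?t \<in> detector_kernel V D" by (rule detector_kernel_minus[OF less.prems])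
      moreover have "card (keys (p - ?t)) < card (keys p)"
        using m by (intro smaller) simp_all
      ultimately have "P (p - ?t)" using less.hyps by blast
      then have "P (p - ?t + ?t)"
        by (rule monom) (use m False keys_mons in blast)+
      then show ?thesis by simp
    qed
  qed (use assms in simp)
qed

text \<open>If the leading monomial is detected, then its partner in the support is smaller.\<close>

lemma reducible_lead_mon:
  assumes r: "term_order V r" and "p \<in> detector_kernel V D" "p \<noteq> 0"
  shows "reducible V D r (lead_mon r p)"
proof -
  have p: "p \<in> carrier (poly_ring V)" using assms(2) detector_kernel_carrier by blast
  note l = lead_mon_props[OF r p assms(3)]
  show ?thesis
    using detector_kernel_partner[OF assms(2) l(1)] l p
    unfolding reducible_def carrier_iff by blast
qed

lemma reducible_is_lead_mon:
  assumes r: "term_order V r" and coh: "coherent V D"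
    and hom: "\<And>m m' b. m \<in> mons V \<Longrightarrow> m' \<in> mons V \<Longrightarrow> D b m \<Longrightarrow> D b m' \<Longrightarrow> mdeg m = mdeg m'"
    and m: "reducible V D r m"
  shows "\<exists>p \<in> detector_kernel V D :: ('v, 'k::field) mpoly set. p \<noteq> 0 \<and> lead_mon r p = m \<and> pdeg p = mdeg m"
proof (cases "\<exists>b. D b m")
  case False
  with m have "single m (1::'k) \<in> detector_kernel V D"
    by (auto simp: reducible_def intro!: single_in_detector_kernel)
  moreover have "lead_mon r (single m (1::'k)) = m"
    using m by (intro lead_mon_eqI[OF r]) (auto intro: term_orderD(2)[OF r] simp: reducible_def)
  moreover have "single m (1::'k) \<noteq> 0" by (metis lookup_single_eq lookup_zero zero_neq_one)
  ultimately show ?thesis by (intro bexI[of _ "single m 1"]) (auto simp: pdeg_def)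
next
  case True
  with m obtain m' b where m': "m \<in> mons V" "m' \<in> mons V" "m' \<noteq> m" "D b m" "D b m'" "(m', m) \<in> r"
    by (auto simp: reducible_def)
  let ?p = "single m 1 - single m' 1 :: ('v, 'k) mpoly"
  have keys: "keys ?p = {m, m'}"
    using m'(3) by (auto simp: in_keys_iff lookup_minus lookup_single when_def split: if_splits)
  have "?p \<in> detector_kernel V D"
    using binomial_in_detector_kernel[of m V m' D] coherentD[OF coh m'(1,2,4,5)] m' by blast
  moreover have "?p \<noteq> 0" using keys by auto
  moreover have "lead_mon r ?p = m"
    by (rule lead_mon_eqI[OF r]) (use keys m' term_orderD(2)[OF r] in auto)
  moreover have "pdeg ?p = mdeg m"
    unfolding pdeg_def keys using hom[OF m'(1,2,4,5)] by simp
  ultimately show ?thesis by blast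
qed

lemma initial_ideal_eq:
  "initial_ideal V r P = Idl\<^bsub>poly_ring V\<^esub> (monomial ` lead_mon r ` (P - {0}))"
  unfolding initial_ideal_def by (rule arg_cong[where f = "genideal _"]) auto

text \<open>Leading monomials of polynomials of degree 2 have degree at most 2, hence exactly 2 by \<open>low\<close>.
Conversely \<open>hom\<close> makes the binomial with a quadratic leading monomial a polynomial of degree 2.
There are only finitely many monomials of degree 2, so the basis is finite.\<close>

lemma quadratic_GB_detector_kernel_iff:
  fixes D :: "'b \<Rightarrow> 'v mon \<Rightarrow> bool"
  assumes fin: "finite V" and coh: "coherent V D"
    and hom: "\<And>m m' b. m \<in> mons V \<Longrightarrow> m' \<in> mons V \<Longrightarrow> D b m \<Longrightarrow> D b m' \<Longrightarrow> mdeg m = mdeg m'"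
    and low: "\<And>r m. reducible V D r m \<Longrightarrow> 2 \<le> mdeg m"
  shows "has_quadratic_GB V (detector_kernel V D :: ('v, 'k::field) mpoly set) \<longleftrightarrow>
    (\<exists>r. term_order V r \<and>
      (\<forall>m. reducible V D r m \<longrightarrow> (\<exists>l c. reducible V D r l \<and> mdeg l = 2 \<and> m = l + c)))"
    (is "?L \<longleftrightarrow> ?R")
proof -
  let ?K = "detector_kernel V D :: ('v, 'k) mpoly set"
  have wit: "\<exists>p\<in>?K. p \<noteq> 0 \<and> lead_mon r p = m \<and> pdeg p = mdeg m"
    if "term_order V r" "reducible V D r m" for r m
    by (rule reducible_is_lead_mon[OF that(1) coh _ that(2)]) (rule hom)
  have lead: "lead_mon r ` (?K - {0}) = {m. reducible V D r m}" if r: "term_order V r" for r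
  proof (intro subset_antisym subsetI)
    fix m assume "m \<in> {m. reducible V D r m}"
    then obtain p where "p \<in> ?K - {0}" "lead_mon r p = m" using wit[OF r, of m] by auto
    then show "m \<in> lead_mon r ` (?K - {0})" by blast
  qed (use reducible_lead_mon[OF r] in auto)
  have red_mons: "{m. reducible V D r m} \<subseteq> mons V" for r by (auto simp: reducible_def)
  show ?thesis
  proof
    assume ?L
    then obtain r and G :: "('v, 'k) mpoly set" where r: "term_order V r"
      and G: "G \<subseteq> ?K" "0 \<notin> G" "initial_ideal V r G = initial_ideal V r ?K" "\<And>g. g \<in> G \<Longrightarrow> pdeg g = 2"
      unfolding has_quadratic_GB_def groebner_basis_def by blast
    have sub: "lead_mon r ` (G - {0}) \<subseteq> {m. reducible V D r m}"
      using G(1) lead[OF r] by blast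
    have "\<exists>l c. reducible V D r l \<and> mdeg l = 2 \<and> m = l + c" if m: "reducible V D r m" for m
    proof -
      have mV: "m \<in> mons V" using m by (simp add: reducible_def)
      have "(monomial m :: ('v, 'k) mpoly) \<in> initial_ideal V r ?K"
        unfolding initial_ideal_eq lead[OF r] using m mV
        by (subst monomial_in_genideal_monomials[OF red_mons])
          (simp, rule bexI[of _ m], rule exI[of _ 0], auto)
      then have "\<exists>l\<in>lead_mon r ` (G - {0}). \<exists>c. m = l + c"
        unfolding G(3)[symmetric] unfolding initial_ideal_eq
        using monomial_in_genideal_monomials[OF order.trans[OF sub red_mons] mV] by blast
      then obtain g c where g: "g \<in> G" "m = lead_mon r g + c" by blast
      have "g \<noteq> 0" "g \<in> carrier (poly_ring V)"
        using g G(1,2) detector_kernel_carrier by auto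
      then have "mdeg (lead_mon r g) \<le> pdeg g"
        using lead_mon_props(1)[OF r] by (auto simp: pdeg_def intro!: Max_ge)
      moreover have "reducible V D r (lead_mon r g)" using sub g G(2) by auto
      ultimately show ?thesis using G(4) g low by (metis le_antisym)
    qed
    with r show ?R by blast
  next
    assume ?R
    then obtain r where r: "term_order V r"
      and quad: "\<And>m. reducible V D r m \<Longrightarrow> \<exists>l c. reducible V D r l \<and> mdeg l = 2 \<and> m = l + c"
      by blast
    \<comment> \<open>The reducible quadrics alone generate the initial ideal.\<close>
    define L where "L = {m. reducible V D r m \<and> mdeg m = 2}"
    have L: "L \<subseteq> mons V" using red_mons by (auto simp: L_def)
    have "\<exists>p. p \<in> ?K \<and> p \<noteq> 0 \<and> lead_mon r p = m \<and> pdeg p = 2" if "m \<in> L" for m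
      using wit[OF r, of m] that unfolding L_def by auto
    then obtain g where g: "\<And>m. m \<in> L \<Longrightarrow> g m \<in> ?K \<and> g m \<noteq> 0 \<and> lead_mon r (g m) = m \<and> pdeg (g m) = 2"
      using bchoice[of L "\<lambda>m p. p \<in> ?K \<and> p \<noteq> 0 \<and> lead_mon r p = m \<and> pdeg p = 2"] by blast
    have "L \<subseteq> {m \<in> mons V. mdeg m = 2}" using L by (auto simp: L_def)
    then have "finite (g ` L)" using finite_mons_mdeg_2[OF fin] finite_subset by blast
    moreover have lead_L: "lead_mon r ` (g ` L - {0}) = L" using g by (auto simp: image_iff)
    have "(\<exists>l\<in>L. \<exists>c. m = l + c) \<longleftrightarrow> (\<exists>l\<in>{m. reducible V D r m}. \<exists>c. m = l + c)" for m
    proof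
      assume "\<exists>l\<in>{m. reducible V D r m}. \<exists>c. m = l + c"
      then obtain l c where "reducible V D r l" "m = l + c" by blast
      moreover from this(1) obtain l' c' where "l' \<in> L" "l = l' + c'"
        using quad unfolding L_def by blast
      ultimately have "l' \<in> L" "m = l' + (c' + c)" by (simp_all add: add.assoc)
      then show "\<exists>l\<in>L. \<exists>c. m = l + c" by blast
    qed (auto simp: L_def)
    then have "initial_ideal V r (g ` L) = initial_ideal V r ?K"
      unfolding initial_ideal_eq lead[OF r] lead_L genideal_monomials[OF red_mons] genideal_monomials[OF L]
      by simp
    moreover have "g ` L \<subseteq> ?K" "0 \<notin> g ` L" using g by (blast, metis imageE)
    ultimately have "groebner_basis V r ?K (g ` L)"
      unfolding groebner_basis_def by blast
    moreover have "\<forall>p\<in>g ` L. pdeg p = 2" using g by blast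
    ultimately show ?L using r unfolding has_quadratic_GB_def by blast
  qed
qed


section \<open>Facet orders\<close>

definition sqfree_mon :: "(nat \<Rightarrow> pvar) \<Rightarrow> nat set \<Rightarrow> pvar mon" where
  "sqfree_mon w A = (\<Sum>i\<in>A. single (w i) 1)"

lemma lookup_sqfree_mon:
  assumes "inj w" "finite A"
  shows "lookup (sqfree_mon w A) v = (if v \<in> w ` A then 1 else 0)"
proof -
  have "lookup (sqfree_mon w A) v = (\<Sum>i\<in>A. if w i = v then 1 else 0)"
    unfolding sqfree_mon_def lookup_sum lookup_single when_def by (rule refl)
  also have "\<dots> = card {i\<in>A. w i = v}"
    using assms(2) by (simp flip: sum.inter_filter)
  also have "{i\<in>A. w i = v} = (if v \<in> w ` A then {inv_into UNIV w v} else {})"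
    using assms(1) by (auto simp: inv_f_f dest: injD)
  finally show ?thesis by auto
qed

lemma mdeg_sqfree_mon: "finite A \<Longrightarrow> mdeg (sqfree_mon w A) = card A"
  by (induction rule: finite_induct) (auto simp: sqfree_mon_def mdeg_add)

lemma sqfree_mon_Un:
  assumes "finite A" "finite B" "A \<inter> B = {}"
  shows "sqfree_mon w (A \<union> B) = sqfree_mon w A + sqfree_mon w B"
  using assms by (simp add: sqfree_mon_def sum.union_disjoint)

lemma sqfree_mon_mons:
  assumes "\<And>i. i \<in> A \<Longrightarrow> w i \<in> V"
  shows "sqfree_mon w A \<in> mons V"
  unfolding sqfree_mon_def
  using assms by (induction A rule: infinite_finite_induct) (auto simp: mons_add_iff mons_zero)

text \<open>The exchange property of a shelling: a facet meets each earlier one in a subset of a ridge that it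
shares with some earlier facet.\<close>

definition exchange_ordered :: "nat set list \<Rightarrow> bool" where
  "exchange_ordered Fs \<longleftrightarrow> distinct Fs \<and>
     (\<forall>i<length Fs. \<forall>j<i. \<exists>k<i. \<exists>x\<in>Fs ! i - Fs ! j. Fs ! i - Fs ! k = {x})"

lemma exists_list_sorted_by_term_order:
  assumes r: "term_order V r" and "finite A" "\<kappa> ` A \<subseteq> mons V"
  shows "\<exists>xs. distinct xs \<and> set xs = A \<and> sorted_wrt (\<lambda>x y. (\<kappa> x, \<kappa> y) \<in> r) xs"
  using assms(2,3)
proof (induction "card A" arbitrary: A)
  case 0
  then show ?case by (intro exI[of _ "[]"]) auto
next
  case (Suc n)
  then have "A \<noteq> {}" by auto
  then obtain a where a: "a \<in> A" "\<And>x. x \<in> A \<Longrightarrow> (\<kappa> x, \<kappa> a) \<in> r"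
    using term_order_max[OF r, of "\<kappa> ` A"] Suc.prems by auto
  have "n = card (A - {a})" using Suc.hyps(2) Suc.prems(1) a(1) by simp
  moreover have "finite (A - {a})" "\<kappa> ` (A - {a}) \<subseteq> mons V" using Suc.prems by auto
  ultimately obtain xs where xs: "distinct xs" "set xs = A - {a}"
    "sorted_wrt (\<lambda>x y. (\<kappa> x, \<kappa> y) \<in> r) xs"
    using Suc.hyps(1)[of "A - {a}"] by blast
  then show ?case using a xs by (intro exI[of _ "xs @ [a]"]) (auto simp: sorted_wrt_append)
qed

text \<open>What the ideals of \<open>R\<^sub>\<Delta>\<close> and \<open>A\<^sub>\<Delta>\<close> have in common. The variables \<open>w i\<close> are those by which the \<open>z\<^sub>F\<close>
are multiplied in the exchange binomials: the \<open>y\<^sub>i\<close> for \<open>R\<^sub>\<Delta>\<close> and the \<open>x\<^sub>i\<close> for \<open>A\<^sub>\<Delta>\<close>.\<close>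

locale facet_detector =
  fixes V :: "pvar set" and D :: "'b \<Rightarrow> pvar mon \<Rightarrow> bool"
    and \<F> :: "nat set set" and w :: "nat \<Rightarrow> pvar"
  assumes finite_V: "finite V" and finite_\<F>: "finite \<F>"
    and finite_facet: "F \<in> \<F> \<Longrightarrow> finite F" and card_facet: "F \<in> \<F> \<Longrightarrow> G \<in> \<F> \<Longrightarrow> card F = card G"
    and inj_w: "inj w" and w_not_Z: "w i \<noteq> Z F"
    and Z_in_V: "F \<in> \<F> \<Longrightarrow> Z F \<in> V" and w_in_V: "F \<in> \<F> \<Longrightarrow> i \<in> F \<Longrightarrow> w i \<in> V"
    and coherent: "coherent V D"
    and detected_divisor: "m + c \<in> mons V \<Longrightarrow> D b (m + c) \<Longrightarrow> \<exists>b'. D b' m"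
    and undetected_quadratic: "m \<in> mons V \<Longrightarrow> (\<And>b. \<not> D b m) \<Longrightarrow>
      \<exists>l c. m = l + c \<and> mdeg l = 2 \<and> (\<forall>b. \<not> D b l)"
    and fibre: "m \<in> mons V \<Longrightarrow> m' \<in> mons V \<Longrightarrow> D b m \<Longrightarrow> D b m' \<Longrightarrow> m \<noteq> m' \<Longrightarrow>
      \<exists>F\<in>\<F>. \<exists>G\<in>\<F>. \<exists>c. F \<noteq> G \<and> m = c + (sqfree_mon w (F - G) + single (Z F) 1) \<and>
        m' = c + (sqfree_mon w (G - F) + single (Z G) 1)"
    and exchange_detected: "F \<in> \<F> \<Longrightarrow> G \<in> \<F> \<Longrightarrow> F \<noteq> G \<Longrightarrow>
      \<exists>b. D b (sqfree_mon w (F - G) + single (Z F) 1) \<and> D b (sqfree_mon w (G - F) + single (Z G) 1)"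
begin

abbreviation exch :: "nat set \<Rightarrow> nat set \<Rightarrow> pvar mon" where
  "exch F G \<equiv> sqfree_mon w (F - G) + single (Z F) 1"

text \<open>The common multiple \<open>exch F G + sqfree_mon w (F \<inter> G)\<close>, which depends on \<open>F\<close> only. It turns the
comparison of exchange monomials into a linear order of the facets.\<close>

abbreviation key :: "nat set \<Rightarrow> pvar mon" where
  "key F \<equiv> sqfree_mon w F + single (Z F) 1"

lemma lookup_sq [simp]: "finite A \<Longrightarrow> lookup (sqfree_mon w A) v = (if v \<in> w ` A then 1 else 0)"
  by (rule lookup_sqfree_mon[OF inj_w])

lemma Z_notin [simp]: "Z F \<notin> w ` A"
  using w_not_Z by (metis imageE)

lemma exch_mons: "F \<in> \<F> \<Longrightarrow> exch F G \<in> mons V"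
  by (auto simp: mons_add_iff Z_in_V w_in_V intro!: sqfree_mon_mons)

lemma key_mons: "F \<in> \<F> \<Longrightarrow> key F \<in> mons V"
  by (auto simp: mons_add_iff Z_in_V w_in_V intro!: sqfree_mon_mons)

lemma mdeg_exch: "F \<in> \<F> \<Longrightarrow> mdeg (exch F G) = Suc (card (F - G))"
  by (simp add: mdeg_add mdeg_sqfree_mon finite_facet)

lemma key_inj: "F \<in> \<F> \<Longrightarrow> G \<in> \<F> \<Longrightarrow> key F = key G \<Longrightarrow> F = G"
  by (drule arg_cong[where f = "\<lambda>m. lookup m (Z F)"])
    (auto simp: lookup_add finite_facet lookup_single when_def split: if_splits)

lemma exch_le_iff:
  assumes r: "term_order V r" and FG: "F \<in> \<F>" "G \<in> \<F>"
  shows "(exch G F, exch F G) \<in> r \<longleftrightarrow> (key G, key F) \<in> r"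
proof -
  have key: "key F = exch F G + sqfree_mon w (F \<inter> G)" if "F \<in> \<F>" for F G
    using sqfree_mon_Un[of "F - G" "F \<inter> G" w] finite_facet[OF that]
    by (simp add: Un_Diff_Int Diff_Int_distrib ac_simps)
  have "sqfree_mon w (F \<inter> G) \<in> mons V" using FG w_in_V by (auto intro!: sqfree_mon_mons)
  then show ?thesis
    unfolding key[OF FG(1), of G] key[OF FG(2), of F] Int_commute[of G F]
    using term_orderD(6)[OF r] term_order_cancel[OF r] by blast
qed

text \<open>Facets of equal size do not contain each other, so an exchange monomial has degree at least 2.\<close>

lemma card_diff_pos: "F \<in> \<F> \<Longrightarrow> G \<in> \<F> \<Longrightarrow> F \<noteq> G \<Longrightarrow> 1 \<le> card (F - G)"
  using card_subset_eq[OF finite_facet, of G F] card_facet[of F G] finite_facet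
  by (auto simp: Suc_le_eq card_gt_0_iff)

lemma fibre_mdeg:
  assumes "m \<in> mons V" "m' \<in> mons V" "D b m" "D b m'"
  shows "mdeg m = mdeg m'"
proof (cases "m = m'")
  case False
  from fibre[OF assms this] obtain F G c where *: "F \<in> \<F>" "G \<in> \<F>" "m = c + exch F G" "m' = c + exch G F"
    by blast
  then have "card (F - G) = card (G - F)"
    using card_facet finite_facet
    by (metis card_Diff_subset_Int finite_Int Int_commute)
  then show ?thesis unfolding *(3,4) using * by (simp add: mdeg_add mdeg_sqfree_mon finite_facet)
qed simp

lemma reducible_mdeg:
  assumes "reducible V D r m"
  shows "2 \<le> mdeg m"
proof (cases "\<exists>b. D b m")
  case True
  then obtain m' b where "m \<in> mons V" "m' \<in> mons V" "D b m" "D b m'" "m \<noteq> m'"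
    using assms by (auto simp: reducible_def)
  from fibre[OF this] obtain F G c where *: "F \<in> \<F>" "G \<in> \<F>" "F \<noteq> G" "m = c + exch F G" by blast
  then show ?thesis using card_diff_pos[OF *(1,2,3)] unfolding *(4) by (simp add: mdeg_add mdeg_sqfree_mon finite_facet)
next
  case False
  then show ?thesis using undetected_quadratic[of m] assms by (auto simp: reducible_def mdeg_add)
qed

lemma reducible_exch:
  assumes "term_order V r" "F \<in> \<F>" "G \<in> \<F>" "F \<noteq> G" "(key G, key F) \<in> r"
  shows "reducible V D r (exch F G)"
proof -
  have "(exch G F, exch F G) \<in> r" using exch_le_iff assms by blast
  moreover have "exch G F \<noteq> exch F G"
  proof
    assume "exch G F = exch F G"
    then have "lookup (exch G F) (Z F) = lookup (exch F G) (Z F)" by simp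
    then show False using assms(2-4) finite_facet by (simp add: lookup_add lookup_single when_def split: if_splits)
  qed
  ultimately show ?thesis
    unfolding reducible_def using exch_mons[OF assms(2)] exch_mons[OF assms(3)] exchange_detected[OF assms(2-4)]
    by blast
qed

lemma reducible_detectedE:
  assumes r: "term_order V r" and "reducible V D r m" "D b m"
  obtains F G c where "F \<in> \<F>" "G \<in> \<F>" "F \<noteq> G" "m = c + exch F G" "(key G, key F) \<in> r"
proof -
  from assms(2,3) obtain m' b where m': "m \<in> mons V" "m' \<in> mons V" "D b m" "D b m'" "m \<noteq> m'" "(m', m) \<in> r"
    by (auto simp: reducible_def)
  from fibre[OF m'(1-5)] obtain F G c where *: "F \<in> \<F>" "G \<in> \<F>" "F \<noteq> G" "m = c + exch F G" "m' = c + exch G F"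
    by blast
  have "(exch G F + c, exch F G + c) \<in> r" using m'(6) unfolding *(4,5) by (simp only: add.commute)
  then have "(key G, key F) \<in> r" using exch_le_iff[OF r *(1,2)] term_order_cancel[OF r] by blast
  with * show ?thesis using that by blast
qed

text \<open>The facets are listed by increasing keys. The quadric dividing \<open>exch F G\<close> is itself a multiple of
an exchange monomial \<open>exch F' H\<close>, and for reasons of degree equal to it with \<open>F' - H\<close> a singleton.
Comparing the variables of \<open>exch F G\<close> identifies \<open>F'\<close> with \<open>F\<close> and puts that singleton into
\<open>F - G\<close>.\<close>

lemma exchange_order_of_term_order:
  assumes r: "term_order V r"
    and quad: "\<And>m. reducible V D r m \<Longrightarrow> \<exists>l c. reducible V D r l \<and> mdeg l = 2 \<and> m = l + c"
  shows "\<exists>Fs. set Fs = \<F> \<and> exchange_ordered Fs"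
proof -
  obtain Fs where Fs: "distinct Fs" "set Fs = \<F>" "sorted_wrt (\<lambda>F G. (key F, key G) \<in> r) Fs"
    using exists_list_sorted_by_term_order[OF r finite_\<F>, of key] key_mons by blast
  have "\<exists>k<i. \<exists>x\<in>Fs ! i - Fs ! j. Fs ! i - Fs ! k = {x}" if ij: "i < length Fs" "j < i" for i j
  proof -
    let ?F = "Fs ! i" and ?G = "Fs ! j"
    have F: "?F \<in> \<F>" and G: "?G \<in> \<F>" using ij Fs(2) by (auto simp: set_conv_nth)
    have ne: "?F \<noteq> ?G" using ij Fs(1) by (simp add: nth_eq_iff_index_eq)
    have "(key ?G, key ?F) \<in> r" using ij Fs(3) by (simp add: sorted_wrt_iff_nth_less)
    then have "reducible V D r (exch ?F ?G)" by (rule reducible_exch[OF r F G ne])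
    then obtain l c where l: "reducible V D r l" "mdeg l = 2" "exch ?F ?G = l + c" using quad by blast
    obtain b where "D b (l + c)" using exchange_detected[OF F G ne] l(3) by metis
    then obtain b' where "D b' l"
      using detected_divisor[of l c b] exch_mons[OF F, of ?G] unfolding l(3) by blast
    then obtain F' H c' where *: "F' \<in> \<F>" "H \<in> \<F>" "F' \<noteq> H" "l = c' + exch F' H" "(key H, key F') \<in> r"
      using reducible_detectedE[OF r l(1)] by metis
    \<comment> \<open>The detected quadric \<open>l\<close> already has degree 2, so \<open>c'\<close> is 1 and one variable \<open>w\<^sub>x\<close> remains.\<close>
    have "mdeg c' + Suc (card (F' - H)) = 2"
      using l(2) mdeg_exch[OF *(1), of H] unfolding *(4) mdeg_add[of c'] by simp
    then have "card (F' - H) = 1" using card_diff_pos[OF *(1-3)] by simp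
    then obtain x where x: "F' - H = {x}" by (auto simp: card_1_singleton_iff)
    have lk: "lookup (exch ?F ?G) v = lookup c' v + lookup (exch F' H) v + lookup c v" for v
      unfolding l(3) *(4) by (simp add: lookup_add)
    have "F' = ?F"
      using lk[of "Z F'"] F *(1) finite_facet
      by (auto simp: lookup_add lookup_single when_def split: if_splits)
    have "x \<in> ?F - ?G"
    proof (rule ccontr)
      assume "x \<notin> ?F - ?G"
      then have "w x \<notin> w ` (?F - ?G)" using inj_w by (auto simp: inj_def)
      then show False using lk[of "w x"] F *(1) finite_facet w_not_Z w_not_Z[THEN not_sym] x
        by (auto simp: lookup_add lookup_single when_def split: if_splits)
    qed
    obtain k where k: "k < length Fs" "Fs ! k = H" using *(2) Fs(2) by (metis in_set_conv_nth)
    have "k < i"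
    proof (rule ccontr)
      assume "\<not> k < i"
      moreover have "k \<noteq> i" using k \<open>F' = ?F\<close> *(3) by auto
      ultimately have "(key ?F, key H) \<in> r" using k Fs(3) by (auto simp: sorted_wrt_iff_nth_less)
      then have "key ?F = key H" using *(5) term_orderD(4)[OF r] unfolding \<open>F' = ?F\<close> by blast
      then show False using key_inj[OF F *(2)] *(3) \<open>F' = ?F\<close> by simp
    qed
    then show ?thesis using x k \<open>F' = ?F\<close> \<open>x \<in> ?F - ?G\<close> by blast
  qed
  then show ?thesis using Fs unfolding exchange_ordered_def by blast
qed

text \<open>The keys of two facets involve different variables \<open>z\<^sub>F\<close>, so a lexicographic order in which these
variables dominate, ranked by position in the list, sorts the keys as prescribed.\<close>

lemma term_order_of_facet_order:
  assumes Fs: "set Fs = \<F>" "distinct Fs"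
  shows "\<exists>r. term_order V r \<and> (\<forall>i<length Fs. \<forall>j<i. (key (Fs ! j), key (Fs ! i)) \<in> r)"
proof -
  obtain f :: "pvar \<Rightarrow> nat" and n where f: "f ` V = {i. i < n}" "inj_on f V"
    using finite_imp_inj_to_nat_seg[OF finite_V] by blast
  define idx where "idx = the_inv_into {..<length Fs} ((!) Fs)"
  have inj: "inj_on ((!) Fs) {..<length Fs}" using Fs(2) by (intro inj_on_nth) auto
  have idx: "idx (Fs ! i) = i" if "i < length Fs" for i
    using the_inv_into_f_f[OF inj] that by (simp add: idx_def)
  have idx_inj: "F = G" if "F \<in> \<F>" "G \<in> \<F>" "idx F = idx G" for F G
    using that idx Fs(1) by (metis in_set_conv_nth)
  \<comment> \<open>The other variables receive ranks below \<open>n\<close>, the \<open>z\<^sub>F\<close> ranks from \<open>n\<close> on.\<close>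
  define \<rho> where "\<rho> v = (if v \<in> Z ` \<F> then n + idx (THE F. v = Z F) else f v)" for v
  have \<rho>_Z: "\<rho> (Z F) = n + idx F" if "F \<in> \<F>" for F using that by (simp add: \<rho>_def)
  have \<rho>_other: "\<rho> v = f v" "\<rho> v < n" if "v \<in> V" "v \<notin> Z ` \<F>" for v
    using that f(1) by (auto simp: \<rho>_def)
  have "inj_on \<rho> V"
  proof (rule inj_onI)
    fix u v assume uv: "u \<in> V" "v \<in> V" "\<rho> u = \<rho> v"
    show "u = v"
    proof (cases "u \<in> Z ` \<F>"; cases "v \<in> Z ` \<F>")
      assume "u \<in> Z ` \<F>" "v \<in> Z ` \<F>"
      then obtain F G where "F \<in> \<F>" "G \<in> \<F>" "u = Z F" "v = Z G" by blast
      then show ?thesis using uv(3) idx_inj[of F G] by (simp add: \<rho>_Z)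
    next
      assume "u \<notin> Z ` \<F>" "v \<notin> Z ` \<F>"
      then show ?thesis using uv f(2) by (auto simp: \<rho>_other inj_on_def)
    next
      assume "u \<in> Z ` \<F>" "v \<notin> Z ` \<F>"
      then show ?thesis using uv(3) \<rho>_other(2)[OF uv(2)] by (auto simp: \<rho>_Z)
    next
      assume "u \<notin> Z ` \<F>" "v \<in> Z ` \<F>"
      then show ?thesis using uv(3) \<rho>_other(2)[OF uv(1)] by (auto simp: \<rho>_Z)
    qed
  qed
  then have r: "term_order V (lex_order V \<rho>)" by (rule term_order_lex_order[OF finite_V])
  have "(key (Fs ! j), key (Fs ! i)) \<in> lex_order V \<rho>" if ij: "i < length Fs" "j < i" for i j
  proof -
    let ?F = "Fs ! i" and ?G = "Fs ! j"
    have F: "?F \<in> \<F>" and G: "?G \<in> \<F>" using ij Fs(1) by (auto simp: set_conv_nth)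
    have ne: "?F \<noteq> ?G" using ij Fs(2) by (simp add: nth_eq_iff_index_eq)
    have "lookup (key ?G) (Z ?F) < lookup (key ?F) (Z ?F)"
      using F G ne finite_facet by (simp add: lookup_add lookup_single when_def)
    moreover have "lookup (key ?G) u = lookup (key ?F) u" if "u \<in> V" "\<rho> u > \<rho> (Z ?F)" for u
    proof -
      have "u \<in> Z ` \<F>" using \<rho>_other(2)[OF that(1)] that(2) by (cases "u \<in> Z ` \<F>") (auto simp: \<rho>_Z[OF F])
      then obtain H where H: "H \<in> \<F>" "u = Z H" by blast
      then have "idx H > i" using that(2) idx ij by (simp add: \<rho>_Z F)
      then have "H \<noteq> ?F" "H \<noteq> ?G" using idx ij by auto
      then show ?thesis using H F G finite_facet by (simp add: lookup_add lookup_single when_def)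
    qed
    ultimately show ?thesis unfolding lex_order_def using key_mons[OF F] key_mons[OF G] Z_in_V[OF F] by blast
  qed
  with r show ?thesis by blast
qed

text \<open>If \<open>F - H = {x}\<close> with \<open>x \<in> F - G\<close>, then the quadric \<open>exch F H\<close>, which is \<open>w\<^sub>x z\<^sub>F\<close>, divides
\<open>exch F G\<close>.\<close>

lemma quadratic_of_exchange_order:
  assumes r: "term_order V r" and Fs: "set Fs = \<F>" "exchange_ordered Fs"
    and sorted: "\<And>i j. i < length Fs \<Longrightarrow> j < i \<Longrightarrow> (key (Fs ! j), key (Fs ! i)) \<in> r"
    and m: "reducible V D r m"
  shows "\<exists>l c. reducible V D r l \<and> mdeg l = 2 \<and> m = l + c"
proof (cases "\<exists>b. D b m")
  case False
  with m obtain l c where *: "m = l + c" "mdeg l = 2" "\<forall>b. \<not> D b l"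
    using undetected_quadratic[of m] by (auto simp: reducible_def)
  moreover have "reducible V D r l" using * m by (simp add: reducible_def mons_add_iff)
  ultimately show ?thesis by blast
next
  case True
  then obtain F G c where *: "F \<in> \<F>" "G \<in> \<F>" "F \<noteq> G" "m = c + exch F G" "(key G, key F) \<in> r"
    using reducible_detectedE[OF r m] by metis
  obtain i j where i: "i < length Fs" "Fs ! i = F" and j: "j < length Fs" "Fs ! j = G"
    using *(1,2) Fs(1) by (metis in_set_conv_nth)
  have "j < i"
  proof (rule ccontr)
    assume "\<not> j < i"
    moreover have "i \<noteq> j" using i j *(3) by auto
    ultimately have "(key F, key G) \<in> r" using sorted[of j i] i j by simp
    then have "key F = key G" using *(5) term_orderD(4)[OF r] by blast
    then show False using key_inj *(1-3) by blast
  qed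
  then obtain k x where k: "k < i" "x \<in> F - G" "F - Fs ! k = {x}"
    using Fs(2) i j unfolding exchange_ordered_def by blast
  define H where "H = Fs ! k"
  have H: "H \<in> \<F>" "F \<noteq> H" "F - H = {x}" using k i Fs(1) by (auto simp: H_def set_conv_nth)
  have "(key H, key F) \<in> r" using sorted[OF i(1) k(1)] i by (simp add: H_def)
  then have "reducible V D r (exch F H)" by (rule reducible_exch[OF r *(1) H(1,2)])
  moreover have "mdeg (exch F H) = 2" using mdeg_exch[OF *(1), of H] H(3) by simp
  moreover have "m = exch F H + (c + sqfree_mon w (F - G - {x}))"
  proof -
    have "F - G = {x} \<union> (F - G - {x})" using k(2) by blast
    then have "sqfree_mon w (F - G) = sqfree_mon w {x} + sqfree_mon w (F - G - {x})"
      using sqfree_mon_Un[of "{x}" "F - G - {x}" w] finite_facet[OF *(1)] by (metis Diff_disjoint finite.emptyI finite.insertI finite_Diff)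
    then show ?thesis unfolding *(4) H(3) by (simp only: ac_simps)
  qed
  ultimately show ?thesis by blast
qed

theorem quadratic_GB_iff_exchange_order:
  "has_quadratic_GB V (detector_kernel V D :: (pvar, 'k::field) mpoly set) \<longleftrightarrow>
    (\<exists>Fs. set Fs = \<F> \<and> exchange_ordered Fs)"
proof -
  have "(\<exists>r. term_order V r \<and>
      (\<forall>m. reducible V D r m \<longrightarrow> (\<exists>l c. reducible V D r l \<and> mdeg l = 2 \<and> m = l + c))) \<longleftrightarrow>
    (\<exists>Fs. set Fs = \<F> \<and> exchange_ordered Fs)" (is "?L = ?R")
  proof
    assume ?L
    then show ?R using exchange_order_of_term_order by blast
  next
    assume ?R
    then obtain Fs where Fs: "set Fs = \<F>" "exchange_ordered Fs" by blast
    then have "distinct Fs" by (simp add: exchange_ordered_def)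
    from term_order_of_facet_order[OF Fs(1) this] obtain r where r: "term_order V r"
      "\<And>i j. i < length Fs \<Longrightarrow> j < i \<Longrightarrow> (key (Fs ! j), key (Fs ! i)) \<in> r" by blast
    have "\<exists>l c. reducible V D r l \<and> mdeg l = 2 \<and> m = l + c" if "reducible V D r m" for m
      by (rule quadratic_of_exchange_order[OF r(1) Fs r(2) that])
    then show ?L using r(1) by blast
  qed
  moreover have "has_quadratic_GB V (detector_kernel V D :: (pvar, 'k) mpoly set) \<longleftrightarrow>
    (\<exists>r. term_order V r \<and>
      (\<forall>m. reducible V D r m \<longrightarrow> (\<exists>l c. reducible V D r l \<and> mdeg l = 2 \<and> m = l + c)))"
    by (rule quadratic_GB_detector_kernel_iff[OF finite_V coherent])
      (rule fibre_mdeg, assumption+, rule reducible_mdeg)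
  ultimately show ?thesis by simp
qed

end


section \<open>Shellings\<close>

lemma face_in_facet:
  assumes "finite \<Gamma>" "A \<in> \<Gamma>"
  shows "\<exists>F\<in>facets \<Gamma>. A \<subseteq> F"
  using finite_has_maximal2[OF assms] unfolding facets_def by blast

text \<open>The facets of the intersection are the maximal sets \<open>F \<inter> H\<close>. Since \<open>F\<close> has as many
elements as each \<open>H\<close> and differs from it, these have at most \<open>d - 1\<close> elements, with equality iff \<open>F - H\<close> is a singleton. So the
intersection is pure of dimension \<open>d - 2\<close> iff each \<open>F \<inter> G\<close> lies in such a ridge.\<close>

lemma shelling_step_iff:
  assumes F: "finite F" "card F = d" "F \<notin> S" and S: "S \<noteq> {}" "\<And>G. G \<in> S \<Longrightarrow> finite G \<and> card G = d"
  defines "\<Gamma> \<equiv> generated_complex S \<inter> generated_complex {F}"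
  shows "pure \<Gamma> \<and> complex_dim \<Gamma> = int d - 2 \<longleftrightarrow> (\<forall>G\<in>S. \<exists>H\<in>S. \<exists>x\<in>F - G. F - H = {x})"
proof -
  have \<Gamma>: "A \<in> \<Gamma> \<longleftrightarrow> A \<subseteq> F \<and> (\<exists>G\<in>S. A \<subseteq> G)" for A
    by (auto simp: \<Gamma>_def generated_complex_def)
  have fin: "finite \<Gamma>" by (rule finite_subset[of _ "Pow F"]) (use \<Gamma> F in auto)
  have finite_face: "finite A" if "A \<in> \<Gamma>" for A
  proof (rule finite_subset[OF _ F(1)])
    show "A \<subseteq> F" using \<Gamma>[of A] that by simp
  qed
  have "{} \<in> \<Gamma>" using \<Gamma>[of "{}"] S(1) by auto
  have card_less: "card (F \<inter> H) < d" if "H \<in> S" for H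
  proof -
    have "\<not> F \<subseteq> H" using card_subset_eq[of H F] S(2)[OF that] F that by auto
    then have "F \<inter> H \<subset> F" by blast
    then show ?thesis using psubset_card_mono F(1,2) by metis
  qed
  show ?thesis
  proof
    assume L: "pure \<Gamma> \<and> complex_dim \<Gamma> = int d - 2"
    have "Max (face_dim ` \<Gamma>) \<in> face_dim ` \<Gamma>" using fin \<open>{} \<in> \<Gamma>\<close> by (intro Max_in) auto
    then obtain A0 where A0: "A0 \<in> \<Gamma>" "face_dim A0 = complex_dim \<Gamma>"
      unfolding complex_dim_def by (metis imageE)
    have "A0 = B" if "B \<in> \<Gamma>" "A0 \<subseteq> B" for B
    proof (rule card_seteq[OF _ that(2)])
      show "finite B" using that(1) by (rule finite_face)
      have "face_dim B \<le> complex_dim \<Gamma>"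
        unfolding complex_dim_def using fin that(1) by (intro Max_ge) auto
      then show "card B \<le> card A0" using A0(2) by (simp add: face_dim_def)
    qed
    then have facet: "A0 \<in> facets \<Gamma>" using A0(1) by (simp add: facets_def)
    show "\<forall>G\<in>S. \<exists>H\<in>S. \<exists>x\<in>F - G. F - H = {x}"
    proof
      fix G assume "G \<in> S"
      then have "F \<inter> G \<in> \<Gamma>" using \<Gamma>[of "F \<inter> G"] \<open>G \<in> S\<close> by blast
      from face_in_facet[OF fin this] obtain A where A: "A \<in> facets \<Gamma>" "F \<inter> G \<subseteq> A" by blast
      then have "face_dim A = face_dim A0" using L facet unfolding pure_def by blast
      then have card_A: "Suc (card A) = d" using A0(2) L by (simp add: face_dim_def)
      from A(1) obtain H where H: "H \<in> S" "A \<subseteq> F \<inter> H" using \<Gamma>[of A] by (auto simp: facets_def)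
      have "A = F \<inter> H" using card_seteq[OF _ H(2)] card_less[OF H(1)] card_A F(1) by simp
      then have "card (F - H) = 1" using card_Diff_subset_Int[of F H] F(1,2) card_A by simp
      then obtain x where x: "F - H = {x}" by (auto simp: card_1_singleton_iff)
      moreover have "x \<in> F - G" using x A(2) H(2) by blast
      ultimately show "\<exists>H\<in>S. \<exists>x\<in>F - G. F - H = {x}" using H(1) by blast
    qed
  next
    assume R: "\<forall>G\<in>S. \<exists>H\<in>S. \<exists>x\<in>F - G. F - H = {x}"
    have ridge: "\<exists>B\<in>\<Gamma>. A \<subseteq> B \<and> face_dim B = int d - 2" if "A \<in> \<Gamma>" for A
    proof -
      from that \<Gamma>[of A] obtain G where G: "G \<in> S" "A \<subseteq> F \<inter> G" by auto
      with R obtain H x where H: "H \<in> S" "x \<in> F - G" "F - H = {x}" by blast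
      have "A \<subseteq> F \<inter> H" using G(2) H(2) H(3)[THEN equalityD1] by blast
      moreover have "F \<inter> H \<in> \<Gamma>" using \<Gamma>[of "F \<inter> H"] H(1) by blast
      moreover have "card (F \<inter> H) = d - 1"
        using card_Diff_subset_Int[of F H] F(1,2) H(3) card_less[OF H(1)] by simp
      then have "face_dim (F \<inter> H) = int d - 2" using card_less[OF H(1)] by (simp add: face_dim_def)
      ultimately show ?thesis by blast
    qed
    have "face_dim A = int d - 2" if "A \<in> facets \<Gamma>" for A
    proof -
      have A: "A \<in> \<Gamma>" "\<forall>B\<in>\<Gamma>. A \<subseteq> B \<longrightarrow> A = B" using that by (simp_all add: facets_def)
      from ridge[OF A(1)] A(2) show ?thesis by metis
    qed
    then have "pure \<Gamma>" by (simp add: pure_def)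
    moreover have "complex_dim \<Gamma> = int d - 2"
      unfolding complex_dim_def
    proof (rule Max_eqI)
      show "int d - 2 \<in> face_dim ` \<Gamma>" using ridge[OF \<open>{} \<in> \<Gamma>\<close>] by (metis imageI)
      fix y assume "y \<in> face_dim ` \<Gamma>"
      then obtain A where A: "A \<in> \<Gamma>" "y = face_dim A" by blast
      then obtain B where "B \<in> \<Gamma>" "A \<subseteq> B" "face_dim B = int d - 2" using ridge by blast
      moreover have "finite B" using \<open>B \<in> \<Gamma>\<close> by (rule finite_face)
      ultimately show "y \<le> int d - 2"
        using card_mono[of B A] A(2) by (simp add: face_dim_def)
    qed (use fin in simp)
    ultimately show "pure \<Gamma> \<and> complex_dim \<Gamma> = int d - 2" ..
  qed
qed

context
  fixes n \<Delta>
  assumes complex: "simplicial_complex n \<Delta>"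
begin

lemma faces_subset: "F \<in> \<Delta> \<Longrightarrow> F \<subseteq> {1..n}"
  using complex by (auto simp: simplicial_complex_def)

lemma subface: "F \<in> \<Delta> \<Longrightarrow> G \<subseteq> F \<Longrightarrow> G \<in> \<Delta>"
  using complex by (auto simp: simplicial_complex_def)

lemma empty_face: "{} \<in> \<Delta>"
  using complex by (auto simp: simplicial_complex_def)

lemma finite_complex: "finite \<Delta>"
  by (rule finite_subset[of _ "Pow {1..n}"]) (use faces_subset in auto)

lemma facets_subset: "facets \<Delta> \<subseteq> \<Delta>"
  by (auto simp: facets_def)

lemma facet_subset: "F \<in> facets \<Delta> \<Longrightarrow> F \<subseteq> {1..n}"
  using faces_subset facets_subset by blast

lemma finite_facets: "finite (facets \<Delta>)"
  using finite_complex facets_subset finite_subset by blast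

lemma finite_facet: "F \<in> facets \<Delta> \<Longrightarrow> finite F"
  using facet_subset finite_subset by blast

lemma face_in_facet_of_complex: "A \<in> \<Delta> \<Longrightarrow> \<exists>F\<in>facets \<Delta>. A \<subseteq> F"
  using face_in_facet[OF finite_complex] .

lemma complex_dim_eq:
  assumes "\<And>F. F \<in> facets \<Delta> \<Longrightarrow> card F = d"
  shows "complex_dim \<Delta> = int d - 1"
  unfolding complex_dim_def
proof (rule Max_eqI)
  show "int d - 1 \<in> face_dim ` \<Delta>"
    using face_in_facet_of_complex[OF empty_face] assms facets_subset
    by (force simp: face_dim_def)
  fix y assume "y \<in> face_dim ` \<Delta>"
  then obtain A F where "A \<subseteq> F" "F \<in> facets \<Delta>" "y = face_dim A" using face_in_facet_of_complex by blast
  then show "y \<le> int d - 1" using card_mono[of F A] finite_facet assms by (simp add: face_dim_def)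
qed (use finite_complex in simp)

lemma shellable_iff_exchange_order:
  assumes "pure \<Delta>"
  shows "shellable \<Delta> \<longleftrightarrow> (\<exists>Fs. set Fs = facets \<Delta> \<and> exchange_ordered Fs)"
proof -
  obtain d where d: "\<And>F. F \<in> facets \<Delta> \<Longrightarrow> card F = d"
    using assms unfolding pure_def face_dim_def by (metis diff_add_cancel of_nat_eq_iff)
  have step: "(let \<Gamma> = generated_complex (set (take i Fs)) \<inter> generated_complex {Fs ! i}
        in pure \<Gamma> \<and> complex_dim \<Gamma> = complex_dim \<Delta> - 1) \<longleftrightarrow>
      (\<forall>j<i. \<exists>k<i. \<exists>x\<in>Fs ! i - Fs ! j. Fs ! i - Fs ! k = {x})"
    if "distinct Fs" "set Fs = facets \<Delta>" "i \<in> {1..<length Fs}" for i Fs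
  proof -
    have take: "set (take i Fs) = (!) Fs ` {..<i}"
      using that(3) by (simp add: nth_image lessThan_atLeast0)
    have facet: "Fs ! j \<in> facets \<Delta>" if "j \<le> i" for j
      using that nth_mem[of j Fs] \<open>i \<in> _\<close> \<open>set Fs = _\<close> by auto
    have "Fs ! i \<notin> set (take i Fs)"
      using that(1,3) by (auto simp: take nth_eq_iff_index_eq)
    moreover have "set (take i Fs) \<noteq> {}" using that(3) by auto
    moreover have "finite G \<and> card G = d" if "G \<in> set (take i Fs)" for G
      using that facet finite_facet d by (auto simp: take)
    ultimately have "pure (generated_complex (set (take i Fs)) \<inter> generated_complex {Fs ! i}) \<and>
        complex_dim (generated_complex (set (take i Fs)) \<inter> generated_complex {Fs ! i}) = int d - 2 \<longleftrightarrow>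
      (\<forall>G\<in>set (take i Fs). \<exists>H\<in>set (take i Fs). \<exists>x\<in>Fs ! i - G. Fs ! i - H = {x})"
      using facet[of i] finite_facet d by (intro shelling_step_iff) auto
    also have "\<dots> \<longleftrightarrow> (\<forall>j\<in>{..<i}. \<exists>k\<in>{..<i}. \<exists>x\<in>Fs ! i - Fs ! j. Fs ! i - Fs ! k = {x})"
      unfolding take by simp
    finally show ?thesis by (simp add: Let_def complex_dim_eq[OF d] Ball_def Bex_def)
  qed
  have "(\<forall>i\<in>{1..<length Fs}.
        let \<Gamma> = generated_complex (set (take i Fs)) \<inter> generated_complex {Fs ! i}
        in pure \<Gamma> \<and> complex_dim \<Gamma> = complex_dim \<Delta> - 1) \<longleftrightarrow>
      (\<forall>i<length Fs. \<forall>j<i. \<exists>k<i. \<exists>x\<in>Fs ! i - Fs ! j. Fs ! i - Fs ! k = {x})"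
    if "distinct Fs" "set Fs = facets \<Delta>" for Fs
  proof -
    have "(\<forall>i\<in>{1..<length Fs}. \<forall>j<i. P i j) \<longleftrightarrow> (\<forall>i<length Fs. \<forall>j<i. P i j)" for P :: "nat \<Rightarrow> nat \<Rightarrow> bool"
      by force
    then show ?thesis using step[OF that] by simp
  qed
  then show ?thesis unfolding shellable_def exchange_ordered_def
    by (intro iff_exI) (simp only: conj_commute conj_left_commute cong: conj_cong)
qed

end


section \<open>Squarefree monomials and flag complexes\<close>

lemma inj_X: "inj X" and inj_Y: "inj Y"
  by (auto intro: injI)

lemma lookup_sqfree_X [simp]:
  assumes "finite A"
  shows "lookup (sqfree_mon X A) (X i) = (if i \<in> A then 1 else 0)"
    "lookup (sqfree_mon X A) (Y i) = 0" "lookup (sqfree_mon X A) (Z F) = 0"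
  by (auto simp: lookup_sqfree_mon[OF inj_X assms])

lemma lookup_sqfree_Y [simp]:
  assumes "finite A"
  shows "lookup (sqfree_mon Y A) (Y i) = (if i \<in> A then 1 else 0)"
    "lookup (sqfree_mon Y A) (X i) = 0" "lookup (sqfree_mon Y A) (Z F) = 0"
  by (auto simp: lookup_sqfree_mon[OF inj_Y assms])

lemma prod_var: "(\<Prod>i\<in>A. var (w i)) = (monomial (sqfree_mon w A) :: (pvar, 'k::field) mpoly)"
proof (induction A rule: infinite_finite_induct)
  case (insert a A)
  then show ?case by (simp add: var_def monomial_mult sqfree_mon_def)
qed (simp_all add: sqfree_mon_def monomial_def)

lemmas xprod_eq = prod_var[of X, folded xprod_def]
lemmas yprod_eq = prod_var[of Y, folded yprod_def]

lemma sqfree_mon_divisor: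
  assumes "inj w" "finite A" "sqfree_mon w A = l + c"
  shows "\<exists>B\<subseteq>A. l = sqfree_mon w B"
proof (intro exI conjI)
  let ?B = "{i \<in> A. lookup l (w i) = 1}"
  have le: "lookup l v \<le> (if v \<in> w ` A then 1 else 0)" for v
    using arg_cong[OF assms(3), of "\<lambda>m. lookup m v"]
    by (simp add: lookup_sqfree_mon[OF assms(1,2)] lookup_add split: if_splits)
  show "l = sqfree_mon w ?B"
  proof (rule poly_mapping_eqI)
    fix v
    have "v \<in> w ` ?B \<longleftrightarrow> v \<in> w ` A \<and> lookup l v = 1" by auto
    then show "lookup l v = lookup (sqfree_mon w ?B) v"
      using le[of v] assms(2) by (auto simp: lookup_sqfree_mon[OF assms(1)] split: if_splits)
  qed
qed auto

lemma sqfree_X_mons: "A \<subseteq> {1..n} \<Longrightarrow> sqfree_mon X A \<in> mons (x_vars n)"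
  by (rule sqfree_mon_mons) (auto simp: x_vars_def)

lemma SR_ideal_eq: "SR_ideal n \<Delta> = Idl\<^bsub>poly_ring (x_vars n)\<^esub>
    (monomial ` sqfree_mon X ` {F. F \<subseteq> {1..n} \<and> F \<notin> \<Delta>} :: (pvar, 'k::field) mpoly set)"
  unfolding SR_ideal_def xprod_eq by (rule arg_cong[where f = "genideal _"]) auto

text \<open>A quadratic monomial generator of the Stanley--Reisner ideal that divides the squarefree \<open>x\<^sup>F\<close> is
\<open>x\<^sub>i x\<^sub>j\<close> with \<open>i \<noteq> j\<close>. It lies in the ideal, so \<open>{i, j}\<close> contains a nonface and is one itself. In
particular every vertex is a face.\<close>

lemma nonface_contains_nonedge:
  assumes "simplicial_complex n \<Delta>" "flag TYPE('k::field) n \<Delta>" "F \<subseteq> {1..n}" "F \<notin> \<Delta>"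
  shows "\<exists>i\<in>F. \<exists>j\<in>F. i \<noteq> j \<and> {i, j} \<notin> \<Delta>"
proof -
  let ?N = "{F. F \<subseteq> {1..n} \<and> F \<notin> \<Delta>}"
  obtain M where M: "M \<subseteq> {m \<in> mons (x_vars n). mdeg m = 2}"
    "(SR_ideal n \<Delta> :: (pvar, 'k) mpoly set) = Idl\<^bsub>poly_ring (x_vars n)\<^esub> (monomial ` M)"
    using assms(2) unfolding flag_def by blast
  have M': "M \<subseteq> mons (x_vars n)" using M(1) by blast
  have N: "sqfree_mon X ` ?N \<subseteq> mons (x_vars n)" using sqfree_X_mons by blast
  have iff: "(\<exists>l\<in>sqfree_mon X ` ?N. \<exists>c. m = l + c) \<longleftrightarrow> (\<exists>l\<in>M. \<exists>c. m = l + c)"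
    if "m \<in> mons (x_vars n)" for m
    using monomial_in_genideal_monomials[OF M' that, where ?'k = 'k]
      monomial_in_genideal_monomials[OF N that, where ?'k = 'k] M(2)
    unfolding SR_ideal_eq by simp
  have finF: "finite F" using assms(3) finite_subset by blast
  have "\<exists>l\<in>sqfree_mon X ` ?N. \<exists>c. sqfree_mon X F = l + c"
    using assms(3,4) by (intro bexI[of _ "sqfree_mon X F"] exI[of _ 0]) auto
  then obtain l c where l: "l \<in> M" "sqfree_mon X F = l + c"
    using iff[OF sqfree_X_mons[OF assms(3)]] by blast
  obtain B where B: "B \<subseteq> F" "l = sqfree_mon X B"
    using sqfree_mon_divisor[OF inj_X finF l(2)] by blast
  have finB: "finite B" using B(1) finF finite_subset by blast
  have "mdeg l = 2" using l(1) M(1) by blast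
  then have "card B = 2" using mdeg_sqfree_mon[OF finB] B(2) by simp
  then obtain i j where ij: "B = {i, j}" "i \<noteq> j" by (auto simp: card_2_iff)
  have "\<exists>l'\<in>M. \<exists>c. l = l' + c" using l(1) by (intro bexI[of _ l] exI[of _ 0]) auto
  then have "\<exists>l'\<in>sqfree_mon X ` ?N. \<exists>c. l = l' + c" using iff[of l] l(1) M' by blast
  then obtain G c' where G: "G \<subseteq> {1..n}" "G \<notin> \<Delta>" "l = sqfree_mon X G + c'" by blast
  have finG: "finite G" using G(1) finite_subset by blast
  have "G \<subseteq> B"
  proof
    fix g assume "g \<in> G"
    then show "g \<in> B"
      using arg_cong[OF G(3), of "\<lambda>m. lookup m (X g)"] finB finG
      by (simp add: B(2) lookup_add split: if_splits)
  qed
  then have "B \<notin> \<Delta>" using G(2) subface[OF assms(1)] by blast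
  then show ?thesis using B(1) ij by blast
qed


section \<open>The inverse system of the facet polynomial\<close>

text \<open>Squarefreeness makes all factors \<open>lookup m v\<close> of the derivatives equal to 1, so that differential
operators act on it by subtracting exponents.\<close>

definition sqfree_support :: "('v, 'k::field) mpoly \<Rightarrow> bool" where
  "sqfree_support f \<longleftrightarrow> (\<forall>m v. lookup f m \<noteq> 0 \<longrightarrow> lookup m v \<le> 1)"

lemma lookup_partial_sqfree:
  assumes "sqfree_support f"
  shows "lookup (partial v f) b = lookup f (b + single v 1)"
proof (cases "lookup f (b + single v 1) = 0")
  case False
  then have "lookup (b + single v 1) v \<le> 1" using assms unfolding sqfree_support_def by blast
  then have "lookup b v = 0" by (simp add: lookup_add)
  then show ?thesis by (simp add: lookup_partial)
qed (simp add: lookup_partial)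

lemma sqfree_support_shift:
  assumes "sqfree_support f" "\<And>b. lookup g b = lookup f (b + c)"
  shows "sqfree_support g"
  unfolding sqfree_support_def
proof (intro allI impI)
  fix m v assume "lookup g m \<noteq> 0"
  then have "lookup (m + c) v \<le> 1" using assms unfolding sqfree_support_def by metis
  then show "lookup m v \<le> 1" by (simp add: lookup_add)
qed

lemma lookup_partial_power_sqfree:
  assumes "sqfree_support f"
  shows "lookup ((partial v ^^ k) f) b = lookup f (b + single v k)"
proof (induction k arbitrary: b)
  case (Suc k)
  have "sqfree_support ((partial v ^^ k) f)" by (rule sqfree_support_shift[OF assms Suc])
  then show ?case
    by (simp add: lookup_partial_sqfree Suc add.assoc flip: single_add)
qed simp

lemma lookup_diff_mon_sqfree:
  fixes f :: "('v, 'k::field) mpoly"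
  assumes "sqfree_support f"
  shows "lookup (diff_mon m f) b = lookup f (b + m)"
proof -
  interpret comp_fun_commute "\<lambda>v. partial v ^^ lookup m v :: ('v, 'k) mpoly \<Rightarrow> ('v, 'k) mpoly"
    by (rule comp_fun_commute_partial_power)
  have "lookup (Finite_Set.fold (\<lambda>v. partial v ^^ lookup m v) f A) b =
      lookup f (b + (\<Sum>v\<in>A. single v (lookup m v)))" if "finite A" for A b
    using that
  proof (induction A arbitrary: b rule: finite_induct)
    case (insert v A)
    have "sqfree_support (Finite_Set.fold (\<lambda>v. partial v ^^ lookup m v) f A)"
      by (rule sqfree_support_shift[OF assms insert.IH])
    then show ?case using insert
      by (simp add: lookup_partial_power_sqfree add.assoc)
  qed simp
  then show ?thesis unfolding diff_mon_def by (simp add: sum_single_lookup)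
qed

lemma lookup_scale: "lookup (single 0 c * g) b = c * lookup g (b :: 'v mon)" for c :: "'k::field"
  by (simp add: map.rep_eq when_def flip: mult_map_scale_conv_mult)

lemma lookup_diff_op_sqfree:
  assumes "sqfree_support f"
  shows "lookup (diff_op p f) b = (\<Sum>m\<in>keys p. lookup p m * lookup f (b + m))"
  by (simp add: diff_op_def lookup_sum lookup_scale lookup_diff_mon_sqfree[OF assms])

abbreviation facet_mon :: "nat set \<Rightarrow> pvar mon" where
  "facet_mon F \<equiv> sqfree_mon X F + single (Z F) 1"

text \<open>The detectors for \<open>A\<^sub>\<Delta>\<close>. The coefficient of \<open>b\<close> in the polynomial obtained by applying an operator
\<open>p\<close> to the facet polynomial is the sum of the coefficients of \<open>p\<close> at the \<open>m\<close> detected by \<open>b\<close>.\<close>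

definition divides_facet_mon :: "nat set set \<Rightarrow> pvar mon \<Rightarrow> pvar mon \<Rightarrow> bool" where
  "divides_facet_mon \<Delta> b m \<longleftrightarrow> (\<exists>F\<in>facets \<Delta>. b + m = facet_mon F)"

lemma facet_mon_inj:
  assumes "finite F" "finite G" "facet_mon F = facet_mon G"
  shows "F = G"
  using arg_cong[OF assms(3), of "\<lambda>m. lookup m (Z F)"] assms(1,2)
  by (simp add: lookup_add lookup_single when_def split: if_splits)

lemma lookup_f_poly:
  assumes "simplicial_complex n \<Delta>"
  shows "lookup (f_poly \<Delta> :: (pvar, 'k::field) mpoly) m = (if \<exists>F\<in>facets \<Delta>. m = facet_mon F then 1 else 0)"
proof -
  have "(f_poly \<Delta> :: (pvar, 'k) mpoly) = (\<Sum>F\<in>facets \<Delta>. monomial (facet_mon F))"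
    by (simp add: f_poly_def var_def xprod_eq monomial_mult add.commute)
  then have sum: "lookup (f_poly \<Delta> :: (pvar, 'k) mpoly) m =
      (\<Sum>F\<in>facets \<Delta>. if facet_mon F = m then 1 else 0)"
    by (simp add: lookup_sum monomial_def lookup_single when_def)
  show ?thesis
  proof (cases "\<exists>F\<in>facets \<Delta>. m = facet_mon F")
    case True
    then obtain F where F: "F \<in> facets \<Delta>" "m = facet_mon F" by blast
    have "(if facet_mon G = m then 1 else 0) = (if G = F then 1 else (0::'k))" if "G \<in> facets \<Delta>" for G
      using facet_mon_inj[of G F] finite_facet[OF assms] that F by auto
    then show ?thesis using True F(1) finite_facets[OF assms] by (simp add: sum)
  next
    case False
    then have "(if facet_mon F = m then 1 else 0) = (0::'k)" if "F \<in> facets \<Delta>" for F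
      using that by auto
    then show ?thesis using False by (simp add: sum)
  qed
qed

lemma Ann_f_poly_eq_detector_kernel:
  assumes "simplicial_complex n \<Delta>"
  shows "Ann V (f_poly \<Delta> :: (pvar, 'k::field) mpoly) = detector_kernel V (divides_facet_mon \<Delta>)"
proof -
  have "sqfree_support (f_poly \<Delta> :: (pvar, 'k) mpoly)"
    unfolding sqfree_support_def
  proof (intro allI impI)
    fix m v assume "lookup (f_poly \<Delta> :: (pvar, 'k) mpoly) m \<noteq> 0"
    then obtain F where "F \<in> facets \<Delta>" "m = facet_mon F"
      by (auto simp: lookup_f_poly[OF assms] split: if_splits)
    then show "lookup m v \<le> 1"
      using finite_facet[OF assms] by (cases v) (auto simp: lookup_add lookup_single when_def)
  qed
  then have "lookup (diff_op p (f_poly \<Delta>)) b = detected_sum (divides_facet_mon \<Delta>) b p"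
    for p :: "(pvar, 'k) mpoly" and b
    unfolding detected_sum_def
    by (simp add: lookup_diff_op_sqfree lookup_f_poly[OF assms] divides_facet_mon_def if_distrib cong: if_cong)
  then have "diff_op p (f_poly \<Delta>) = 0 \<longleftrightarrow> (\<forall>b. detected_sum (divides_facet_mon \<Delta>) b p = 0)"
    for p :: "(pvar, 'k) mpoly"
    by (metis lookup_zero poly_mapping_eqI)
  then show ?thesis unfolding Ann_def detector_kernel_def by blast
qed


context
  fixes n :: nat and \<Delta> :: "nat set set"
  assumes complex: "simplicial_complex n \<Delta>" and pure: "pure \<Delta>"
    and flag: "flag TYPE('k::field) n \<Delta>"
begin

text \<open>The excluded quadrics force \<open>m\<close> to be squarefree, to contain at most one \<open>z\<^sub>F\<close>, and to have as
\<open>x\<close>-part a face (by flagness), which lies in \<open>F\<close> if \<open>z\<^sub>F\<close> occurs.\<close>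

lemma mon_le_facet_mon:
  assumes m: "m \<in> mons (Q_vars n \<Delta>)"
    and z: "\<And>F G. F \<in> facets \<Delta> \<Longrightarrow> G \<in> facets \<Delta> \<Longrightarrow> \<not> (\<exists>c. m = single (Z F) 1 + single (Z G) 1 + c)"
    and sq: "\<And>i. i \<in> {1..n} \<Longrightarrow> \<not> (\<exists>c. m = single (X i) 1 + single (X i) 1 + c)"
    and xz: "\<And>i F. i \<in> {1..n} \<Longrightarrow> F \<in> facets \<Delta> \<Longrightarrow> i \<notin> F \<Longrightarrow> \<not> (\<exists>c. m = single (X i) 1 + single (Z F) 1 + c)"
    and nonedge: "\<And>i j. i \<in> {1..n} \<Longrightarrow> j \<in> {1..n} \<Longrightarrow> i \<noteq> j \<Longrightarrow> {i, j} \<notin> \<Delta> \<Longrightarrow>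
      \<not> (\<exists>c. m = single (X i) 1 + single (X j) 1 + c)"
  shows "\<exists>F\<in>facets \<Delta>. \<forall>v. lookup m v \<le> lookup (facet_mon F) v"
proof -
  have div: "\<exists>c. m = single u 1 + single v 1 + c" if "\<And>t. lookup (single u 1 + single v 1) t \<le> lookup m t" for u v
    using mon_cancel[OF that] by blast
  have keysX: "i \<in> {1..n}" if "lookup m (X i) \<noteq> 0" for i
  proof -
    have "X i \<in> keys m" using that by (simp add: in_keys_iff)
    then show ?thesis using m by (auto simp: mons_def Q_vars_def)
  qed
  have keysY: "lookup m (Y i) = 0" for i
  proof (rule ccontr)
    assume "lookup m (Y i) \<noteq> 0"
    then have "Y i \<in> keys m" by (simp add: in_keys_iff)
    then show False using m by (auto simp: mons_def Q_vars_def)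
  qed
  have keysZ: "F \<in> facets \<Delta>" if "lookup m (Z F) \<noteq> 0" for F
  proof -
    have "Z F \<in> keys m" using that by (simp add: in_keys_iff)
    then show ?thesis using m by (auto simp: mons_def Q_vars_def)
  qed
  have X1: "lookup m (X i) \<le> 1" for i
  proof (rule ccontr)
    assume two: "\<not> lookup m (X i) \<le> 1"
    then have "\<exists>c. m = single (X i) 1 + single (X i) 1 + c"
      by (intro div) (auto simp: lookup_add lookup_single when_def)
    then show False using sq[of i] keysX[of i] two by simp
  qed
  have Z1: "lookup m (Z F) \<le> 1" for F
  proof (rule ccontr)
    assume two: "\<not> lookup m (Z F) \<le> 1"
    then have "\<exists>c. m = single (Z F) 1 + single (Z F) 1 + c"
      by (intro div) (auto simp: lookup_add lookup_single when_def)
    then show False using z[of F F] keysZ[of F] two by simp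
  qed
  have Z2: "F = G" if "lookup m (Z F) \<noteq> 0" "lookup m (Z G) \<noteq> 0" for F G
  proof (rule ccontr)
    assume "F \<noteq> G"
    then have "\<exists>c. m = single (Z F) 1 + single (Z G) 1 + c"
      by (intro div) (use that in \<open>auto simp: lookup_add lookup_single when_def\<close>)
    then show False using that z[of F G] keysZ by blast
  qed
  have XZ: "i \<in> F" if "lookup m (X i) \<noteq> 0" "lookup m (Z F) \<noteq> 0" for i F
  proof (rule ccontr)
    assume "i \<notin> F"
    then have "\<exists>c. m = single (X i) 1 + single (Z F) 1 + c"
      by (intro div) (use that in \<open>auto simp: lookup_add lookup_single when_def\<close>)
    then show False using that xz[of i F] keysX keysZ \<open>i \<notin> F\<close> by blast
  qed
  let ?A = "{i. lookup m (X i) \<noteq> 0}"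
  have A: "?A \<in> \<Delta>"
  proof (rule ccontr)
    assume "?A \<notin> \<Delta>"
    then obtain i j where ij: "i \<in> ?A" "j \<in> ?A" "i \<noteq> j" "{i, j} \<notin> \<Delta>"
      using nonface_contains_nonedge[OF complex flag, of ?A] keysX by blast
    then have "\<exists>c. m = single (X i) 1 + single (X j) 1 + c"
      by (intro div) (auto simp: lookup_add lookup_single when_def)
    then show False using nonedge[of i j] keysX ij by simp
  qed
  obtain F where F: "F \<in> facets \<Delta>" "?A \<subseteq> F" "\<And>G. lookup m (Z G) \<noteq> 0 \<Longrightarrow> G = F"
  proof (cases "\<exists>F. lookup m (Z F) \<noteq> 0")
    case True
    then obtain F where "lookup m (Z F) \<noteq> 0" by blast
    then show ?thesis using that[of F] XZ[of _ F] Z2[of _ F] keysZ[of F] by blast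
  next
    case False
    then show ?thesis using that face_in_facet_of_complex[OF complex A] by blast
  qed
  have "lookup m v \<le> lookup (facet_mon F) v" for v
  proof (cases v)
    case (X i)
    then show ?thesis using X1[of i] F(2) finite_facet[OF complex F(1)]
      by (auto simp: lookup_add lookup_single when_def)
  next
    case (Y i)
    then show ?thesis using keysY by simp
  next
    case (Z G)
    then show ?thesis using Z1[of G] F(3)[of G] finite_facet[OF complex F(1)]
      by (cases "lookup m (Z G) = 0") (auto simp: lookup_add lookup_single when_def)
  qed
  with F(1) show ?thesis by blast
qed

text \<open>Each of the quadrics excluded by \<open>mon_le_facet_mon\<close> divides no monomial of the facet polynomial.\<close>

lemma undetected_quadratic_A:
  assumes m: "m \<in> mons (Q_vars n \<Delta>)" and und: "\<And>b. \<not> divides_facet_mon \<Delta> b m"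
  shows "\<exists>l c. m = l + c \<and> mdeg l = 2 \<and> (\<forall>b. \<not> divides_facet_mon \<Delta> b l)"
proof (rule ccontr)
  assume no: "\<not> ?thesis"
  have quad: "\<exists>H\<in>facets \<Delta>. \<forall>v. lookup (single s 1 + single t 1) v \<le> lookup (facet_mon H) v"
    if m_eq: "m = single s 1 + single t 1 + c" for s t c
  proof -
    have "mdeg (single s 1 + single t (1::nat)) = 2" by (simp add: mdeg_add)
    then obtain b H where H: "H \<in> facets \<Delta>" "b + (single s 1 + single t 1) = facet_mon H"
      using no m_eq unfolding divides_facet_mon_def by blast
    have "lookup (single s 1 + single t 1) v \<le> lookup (facet_mon H) v" for v
      unfolding H(2)[symmetric] by (simp add: lookup_add)
    with H(1) show ?thesis by blast
  qed
  have "\<exists>F\<in>facets \<Delta>. \<forall>v. lookup m v \<le> lookup (facet_mon F) v"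
  proof (rule mon_le_facet_mon[OF m]; rule notI; elim exE)
    fix F G c assume "m = single (Z F) 1 + single (Z G) 1 + c"
    from quad[OF this] obtain H where H: "H \<in> facets \<Delta>"
      "\<And>v. lookup (single (Z F) 1 + single (Z G) 1) v \<le> lookup (facet_mon H) v" by blast
    show False using H(2)[of "Z F"] H(2)[of "Z G"] finite_facet[OF complex H(1)]
      by (auto simp: lookup_add lookup_single when_def split: if_splits)
  next
    fix i c assume "m = single (X i) 1 + single (X i) 1 + c"
    from quad[OF this] obtain H where H: "H \<in> facets \<Delta>"
      "\<And>v. lookup (single (X i) 1 + single (X i) 1) v \<le> lookup (facet_mon H) v" by blast
    show False using H(2)[of "X i"] finite_facet[OF complex H(1)]
      by (auto simp: lookup_add lookup_single when_def split: if_splits)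
  next
    fix i F c assume "i \<notin> F" "m = single (X i) 1 + single (Z F) 1 + c"
    from quad[OF this(2)] obtain H where H: "H \<in> facets \<Delta>"
      "\<And>v. lookup (single (X i) 1 + single (Z F) 1) v \<le> lookup (facet_mon H) v" by blast
    show False using \<open>i \<notin> F\<close> H(2)[of "X i"] H(2)[of "Z F"] finite_facet[OF complex H(1)]
      by (auto simp: lookup_add lookup_single when_def split: if_splits)
  next
    fix i j c assume ij: "{i, j} \<notin> \<Delta>" "m = single (X i) 1 + single (X j) 1 + c"
    from quad[OF ij(2)] obtain H where H: "H \<in> facets \<Delta>"
      "\<And>v. lookup (single (X i) 1 + single (X j) 1) v \<le> lookup (facet_mon H) v" by blast
    have "{i, j} \<subseteq> H" using H(2)[of "X i"] H(2)[of "X j"] finite_facet[OF complex H(1)]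
      by (auto simp: lookup_add lookup_single when_def split: if_splits)
    then show False using subface[OF complex] H(1) facets_subset[OF complex] ij(1) by blast
  qed
  then obtain F where "F \<in> facets \<Delta>" "\<And>v. lookup m v \<le> lookup (facet_mon F) v" by blast
  moreover from mon_cancel[OF this(2)] have "(facet_mon F - m) + m = facet_mon F"
    by (simp add: add.commute)
  ultimately show False using und unfolding divides_facet_mon_def by blast
qed

lemma facet_mon_split:
  assumes "F \<in> facets \<Delta>"
  shows "facet_mon F = sqfree_mon X (F \<inter> G) + (sqfree_mon X (F - G) + single (Z F) 1)"
  using sqfree_mon_Un[of "F - G" "F \<inter> G" X] finite_facet[OF complex assms]
  by (simp add: Un_Diff_Int Diff_Int_distrib ac_simps)

text \<open>A common detector of monomials belonging to \<open>F\<close> and \<open>G\<close> divides both \<open>x\<^sup>F z\<^sub>F\<close> and \<open>x\<^sup>G z\<^sub>G\<close>. So it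
divides \<open>x\<^bsup>F \<inter> G\<^esup>\<close>, and the quotient is the common factor \<open>c\<close>.\<close>

lemma fibre_A:
  assumes D: "divides_facet_mon \<Delta> b m" "divides_facet_mon \<Delta> b m'" and "m \<noteq> m'"
  shows "\<exists>F\<in>facets \<Delta>. \<exists>G\<in>facets \<Delta>. \<exists>c. F \<noteq> G \<and> m = c + (sqfree_mon X (F - G) + single (Z F) 1) \<and>
        m' = c + (sqfree_mon X (G - F) + single (Z G) 1)"
proof -
  obtain F G where F: "F \<in> facets \<Delta>" "b + m = facet_mon F" and G: "G \<in> facets \<Delta>" "b + m' = facet_mon G"
    using D unfolding divides_facet_mon_def by blast
  note fin = finite_facet[OF complex F(1)] finite_facet[OF complex G(1)]
  have ne: "F \<noteq> G" using F(2) G(2) \<open>m \<noteq> m'\<close> by (metis add_left_cancel)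
  have le: "lookup b v \<le> lookup (facet_mon F) v" "lookup b v \<le> lookup (facet_mon G) v" for v
    unfolding F(2)[symmetric] G(2)[symmetric] by (simp_all add: lookup_add)
  have "lookup b v \<le> lookup (sqfree_mon X (F \<inter> G)) v" for v
    using le[of v] ne fin by (cases v) (auto simp: lookup_add lookup_single when_def split: if_splits)
  then obtain c where c: "sqfree_mon X (F \<inter> G) = b + c" using mon_cancel by blast
  have "b + m = b + (c + (sqfree_mon X (F - G) + single (Z F) 1))"
    unfolding F(2) facet_mon_split[OF F(1), of G] c by (simp only: ac_simps)
  moreover have "b + m' = b + (c + (sqfree_mon X (G - F) + single (Z G) 1))"
    unfolding G(2) facet_mon_split[OF G(1), of F] Int_commute[of G F] c by (simp only: ac_simps)
  ultimately show ?thesis using F(1) G(1) ne unfolding add_left_cancel by blast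
qed

lemma coherent_A: "coherent V (divides_facet_mon \<Delta>)"
  unfolding coherent_def
proof (intro ballI allI impI)
  fix m m' b b'
  assume D: "divides_facet_mon \<Delta> b m" "divides_facet_mon \<Delta> b m'" "divides_facet_mon \<Delta> b' m"
  show "divides_facet_mon \<Delta> b' m'"
  proof (cases "m = m'")
    case False
    from fibre_A[OF D(1,2) this] obtain F G c where FG: "F \<in> facets \<Delta>" "G \<in> facets \<Delta>"
      "m = c + (sqfree_mon X (F - G) + single (Z F) 1)" "m' = c + (sqfree_mon X (G - F) + single (Z G) 1)"
      by blast
    obtain H where H: "H \<in> facets \<Delta>" "b' + m = facet_mon H" using D(3) unfolding divides_facet_mon_def by blast
    have "lookup (b' + m) (Z F) \<ge> 1" unfolding FG(3) by (simp add: lookup_add)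
    then have "H = F" unfolding H(2) using finite_facet[OF complex H(1)]
      by (simp add: lookup_add lookup_single when_def split: if_splits)
    have "(sqfree_mon X (F - G) + single (Z F) 1) + (b' + c) =
      (sqfree_mon X (F - G) + single (Z F) 1) + sqfree_mon X (F \<inter> G)"
      using H(2) unfolding \<open>H = F\<close> facet_mon_split[OF FG(1), of G] FG(3) by (simp only: ac_simps)
    then have "b' + c = sqfree_mon X (F \<inter> G)" unfolding add_left_cancel .
    then have "b' + m' = facet_mon G"
      unfolding FG(4) facet_mon_split[OF FG(2), of F] Int_commute[of G F] by (simp only: add.assoc[symmetric])
    then show ?thesis using FG(2) unfolding divides_facet_mon_def by blast
  qed (use D in simp)
qed

lemma card_facets:
  "F \<in> facets \<Delta> \<Longrightarrow> G \<in> facets \<Delta> \<Longrightarrow> card F = card G"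
  using pure unfolding pure_def face_dim_def by (metis diff_add_cancel of_nat_eq_iff)

lemma A_facet_detector:
  "facet_detector (Q_vars n \<Delta>) (divides_facet_mon \<Delta>) (facets \<Delta>) X"
proof
  show "finite (Q_vars n \<Delta>)" using finite_facets[OF complex] by (simp add: Q_vars_def)
  show "finite (facets \<Delta>)" by (rule finite_facets[OF complex])
  show "finite F" if "F \<in> facets \<Delta>" for F using finite_facet[OF complex that] .
  show "card F = card G" if "F \<in> facets \<Delta>" "G \<in> facets \<Delta>" for F G
    using card_facets[OF that] .
  show "inj X" by (rule inj_X)
  show "X i \<noteq> Z F" for i F by simp
  show "Z F \<in> Q_vars n \<Delta>" if "F \<in> facets \<Delta>" for F using that by (simp add: Q_vars_def)
  show "X i \<in> Q_vars n \<Delta>" if "F \<in> facets \<Delta>" "i \<in> F" for F i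
    using that facet_subset[OF complex] by (auto simp: Q_vars_def)
  show "coherent (Q_vars n \<Delta>) (divides_facet_mon \<Delta>)" by (rule coherent_A)
  show "\<exists>b'. divides_facet_mon \<Delta> b' m" if "divides_facet_mon \<Delta> b (m + c)" for m c b
    using that unfolding divides_facet_mon_def by (metis add.assoc add.commute)
  show "\<exists>l c. m = l + c \<and> mdeg l = 2 \<and> (\<forall>b. \<not> divides_facet_mon \<Delta> b l)"
    if "m \<in> mons (Q_vars n \<Delta>)" "\<And>b. \<not> divides_facet_mon \<Delta> b m" for m
    by (rule undetected_quadratic_A[OF that])
  show "\<exists>b. divides_facet_mon \<Delta> b (sqfree_mon X (F - G) + single (Z F) 1) \<and>
      divides_facet_mon \<Delta> b (sqfree_mon X (G - F) + single (Z G) 1)"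
    if "F \<in> facets \<Delta>" "G \<in> facets \<Delta>" for F G
    using facet_mon_split[OF that(1), of G] facet_mon_split[OF that(2), of F] that
    unfolding divides_facet_mon_def by (metis Int_commute)
qed (rule fibre_A)

theorem A_has_quadratic_GB_iff:
  "A_has_quadratic_GB TYPE('k) n \<Delta> \<longleftrightarrow> (\<exists>Fs. set Fs = facets \<Delta> \<and> exchange_ordered Fs)"
  unfolding A_has_quadratic_GB_def Ann_f_poly_eq_detector_kernel[OF complex]
  by (rule facet_detector.quadratic_GB_iff_exchange_order[OF A_facet_detector])

end


section \<open>The ideal of the idealization\<close>

text \<open>Multiplication by a monomial maps undetected monomials to undetected ones and, by \<open>compat\<close>,
preserves the relation of having a common detector.\<close>

lemma detector_kernel_ideal:
  fixes D :: "'b \<Rightarrow> 'v mon \<Rightarrow> bool"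
  assumes coh: "coherent V D"
    and divisor: "\<And>m c b. m + c \<in> mons V \<Longrightarrow> D b (m + c) \<Longrightarrow> \<exists>b'. D b' m"
    and compat: "\<And>m m' c b b'. D b m \<Longrightarrow> D b m' \<Longrightarrow> D b' (m + c) \<Longrightarrow> D b' (m' + c)"
  shows "ideal (detector_kernel V D :: ('v, 'k::field) mpoly set) (poly_ring V)"
proof (rule ideal_poly_ringI)
  fix p x :: "('v, 'k) mpoly"
  assume p: "p \<in> detector_kernel V D" and x: "x \<in> carrier (poly_ring V)"
  show "x * p \<in> detector_kernel V D"
  proof (rule mult_closed_if_term_mult_closed[OF detector_kernel_0 detector_kernel_add _ x])
    fix c and k :: 'k assume c: "c \<in> mons V"
    show "single c k * p \<in> detector_kernel V D"
      using p coh
    proof (induction rule: detector_kernel_induct)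
      case zero
      then show ?case by (simp add: detector_kernel_0)
    next
      case (monom q m j)
      have "\<not> D b (c + m)" for b
        using divisor[of m c b] monom.hyps c by (auto simp: mons_add_iff add.commute)
      then have "single (c + m) (k * j) \<in> detector_kernel V D"
        using monom.hyps c by (intro single_in_detector_kernel) (simp_all add: mons_add_iff)
      then show ?case
        using detector_kernel_add[OF monom.IH] by (simp add: distrib_left mult_single)
    next
      case (binom q m m' b j)
      have "D b' (c + m) \<longleftrightarrow> D b' (c + m')" for b'
        using compat[of b m m' b' c] compat[of b m' m b' c] binom.hyps by (auto simp: add.commute)
      then have "single (c + m) (k * j) - single (c + m') (k * j) \<in> detector_kernel V D"
        using binom.hyps c by (intro binomial_in_detector_kernel) (simp_all add: mons_add_iff)
      then show ?case
        using detector_kernel_add[OF binom.IH] by (simp add: distrib_left right_diff_distrib mult_single)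
    qed
  qed
qed (use detector_kernel_carrier detector_kernel_0 detector_kernel_add in auto)

text \<open>The monomials that are nonzero in the face ring of \<open>\<Gamma>\<close>.\<close>

definition Gamma_mon :: "nat \<Rightarrow> nat set set \<Rightarrow> pvar mon \<Rightarrow> bool" where
  "Gamma_mon n \<Delta> e \<longleftrightarrow> e \<in> mons (S_vars n) \<and> {i. lookup e (X i) \<noteq> 0} \<in> \<Delta> \<and>
     (\<forall>i. lookup e (X i) = 0 \<or> lookup e (Y i) = 0)"

text \<open>The detectors for \<open>R\<^sub>\<Delta>\<close> are the monomials of two copies of the face ring of \<open>\<Gamma>\<close>. The copy with
\<open>fst b\<close> true contains the canonical module as the monomial ideal generated by the images
\<open>y\<^bsup>[n] - F\<^esup>\<close> of the \<open>z\<^sub>F\<close>; the exchange relations hold there because \<open>y\<^bsup>F - G\<^esup> y\<^bsup>[n] - F\<^esup>\<close> is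
\<open>y\<^bsup>[n] - F \<inter> G\<^esup>\<close>, which is symmetric in \<open>F\<close> and \<open>G\<close>.\<close>

definition R_detector :: "nat \<Rightarrow> nat set set \<Rightarrow> bool \<times> pvar mon \<Rightarrow> pvar mon \<Rightarrow> bool" where
  "R_detector n \<Delta> b m \<longleftrightarrow> Gamma_mon n \<Delta> (snd b) \<and>
     (if fst b
      then \<exists>F\<in>facets \<Delta>. m + sqfree_mon Y ({1..n} - F) = snd b + single (Z F) 1
      else m = snd b)"

text \<open>The quadratic monomials in the ideal of \<open>R\<^sub>\<Delta>\<close>; for flag \<open>\<Delta>\<close> they generate all its monomials.\<close>

definition R_quads :: "nat \<Rightarrow> nat set set \<Rightarrow> pvar mon set" where
  "R_quads n \<Delta> =
     {single (X i) 1 + single (Y i) 1 | i. i \<in> {1..n}} \<union>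
     {single (X i) 1 + single (X j) 1 | i j. i \<in> {1..n} \<and> j \<in> {1..n} \<and> i \<noteq> j \<and> {i, j} \<notin> \<Delta>} \<union>
     {single (X i) 1 + single (Z F) 1 | i F. i \<in> {1..n} \<and> F \<in> facets \<Delta> \<and> i \<notin> F} \<union>
     {single (Z F) 1 + single (Z G) 1 | F G. F \<in> facets \<Delta> \<and> G \<in> facets \<Delta>}"

lemma R_quads_cases [consumes 1, case_names xy xx xz zz]:
  assumes "q \<in> R_quads n \<Delta>"
  obtains i where "i \<in> {1..n}" "q = single (X i) 1 + single (Y i) 1"
    | i j where "i \<in> {1..n}" "j \<in> {1..n}" "i \<noteq> j" "{i, j} \<notin> \<Delta>" "q = single (X i) 1 + single (X j) 1"
    | i F where "i \<in> {1..n}" "F \<in> facets \<Delta>" "i \<notin> F" "q = single (X i) 1 + single (Z F) 1"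
    | F G where "F \<in> facets \<Delta>" "G \<in> facets \<Delta>" "q = single (Z F) 1 + single (Z G) 1"
  using assms unfolding R_quads_def Un_iff mem_Collect_eq
  by (elim disjE exE conjE) ((rule that(1); assumption), (rule that(2); assumption),
    (rule that(3); assumption), (rule that(4); assumption))

lemma S_vars_mon_no_Z:
  assumes "e \<in> mons (S_vars n)" shows "lookup e (Z F) = 0"
proof -
  have "Z F \<notin> keys e" using assms by (auto simp: mons_def S_vars_def)
  then show ?thesis by (simp add: in_keys_iff)
qed

lemma mons_S_varsI:
  assumes "m \<in> mons (T_vars n \<Delta>)" "\<And>F. lookup m (Z F) = 0"
  shows "m \<in> mons (S_vars n)"
  using assms unfolding mons_def T_vars_def by (auto simp: in_keys_iff[symmetric])

context
  fixes n :: nat and \<Delta> :: "nat set set"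
  assumes complex: "simplicial_complex n \<Delta>"
begin

lemma Gamma_mon_divisor:
  assumes "Gamma_mon n \<Delta> (a + b)"
  shows "Gamma_mon n \<Delta> a"
proof -
  have "{i. lookup a (X i) \<noteq> 0} \<subseteq> {i. lookup (a + b) (X i) \<noteq> 0}" by (auto simp: lookup_add)
  then have "{i. lookup a (X i) \<noteq> 0} \<in> \<Delta>"
    using assms subface[OF complex] unfolding Gamma_mon_def by blast
  then show ?thesis using assms by (auto simp: Gamma_mon_def mons_add_iff lookup_add)
qed

lemma R_detector_False: "R_detector n \<Delta> (False, e) m \<longleftrightarrow> Gamma_mon n \<Delta> e \<and> m = e"
  by (auto simp: R_detector_def)

lemma R_detector_TrueE:
  assumes "R_detector n \<Delta> (True, e) m"
  obtains F where "F \<in> facets \<Delta>" "m + sqfree_mon Y ({1..n} - F) = e + single (Z F) 1"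
    "Gamma_mon n \<Delta> e" "\<forall>G. lookup m (Z G) = (if G = F then 1 else 0)"
proof -
  obtain F where F: "F \<in> facets \<Delta>" "m + sqfree_mon Y ({1..n} - F) = e + single (Z F) 1" "Gamma_mon n \<Delta> e"
    using assms by (auto simp: R_detector_def)
  moreover have "lookup m (Z G) = (if G = F then 1 else 0)" for G
    using arg_cong[OF F(2), of "\<lambda>m. lookup m (Z G)"] F(3)
    by (auto simp: lookup_add lookup_single when_def S_vars_mon_no_Z Gamma_mon_def)
  ultimately show ?thesis using that[of F] by blast
qed

lemma R_detector_TrueI:
  assumes "F \<in> facets \<Delta>" "m + sqfree_mon Y ({1..n} - F) = e + single (Z F) 1" "Gamma_mon n \<Delta> e"
  shows "R_detector n \<Delta> (True, e) m"
  using assms by (auto simp: R_detector_def)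

lemma R_detector_True_False:
  assumes "R_detector n \<Delta> (True, e) m" "R_detector n \<Delta> (False, e') m"
  shows False
proof -
  from assms(1) obtain F where "lookup m (Z F) = 1"
    by (rule R_detector_TrueE) (use that in auto)
  moreover have "m \<in> mons (S_vars n)" using assms(2) by (simp add: R_detector_False Gamma_mon_def)
  ultimately show False using S_vars_mon_no_Z[of m n F] by simp
qed

lemma R_detector_True_unique:
  assumes "R_detector n \<Delta> (True, e) m" "R_detector n \<Delta> (True, e') m"
  shows "e = e'"
proof -
  from assms(1) obtain F where F: "m + sqfree_mon Y ({1..n} - F) = e + single (Z F) 1"
    "\<forall>G. lookup m (Z G) = (if G = F then 1 else 0)" by (rule R_detector_TrueE) (rule that)
  from assms(2) obtain G where G: "m + sqfree_mon Y ({1..n} - G) = e' + single (Z G) 1"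
    "\<forall>H. lookup m (Z H) = (if H = G then 1 else 0)" by (rule R_detector_TrueE) (rule that)
  have "F = G"
  proof (rule ccontr)
    assume "F \<noteq> G"
    then have "lookup m (Z F) = 0" using G(2) by simp
    moreover have "lookup m (Z F) = 1" using F(2) by simp
    ultimately show False by simp
  qed
  then have "e + single (Z F) 1 = e' + single (Z F) 1" using F(1) G(1) by (metis (no_types))
  then show ?thesis unfolding add_right_cancel .
qed

text \<open>A detector is the image of the monomial, so coherence is immediate.\<close>

lemma R_detector_unique:
  assumes "R_detector n \<Delta> b m" "R_detector n \<Delta> b' m"
  shows "b = b'"
proof -
  obtain s e s' e' where b: "b = (s, e)" "b' = (s', e')" by (metis surj_pair)
  show ?thesis
  proof (cases s; cases s')
    assume "s" "s'"
    then show ?thesis using R_detector_True_unique[of e m e'] assms b by simp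
  next
    assume "s" "\<not> s'"
    then show ?thesis using R_detector_True_False[of e m e'] assms b by simp
  next
    assume "\<not> s" "s'"
    then show ?thesis using R_detector_True_False[of e' m e] assms b by simp
  next
    assume "\<not> s" "\<not> s'"
    then show ?thesis using assms b by (simp add: R_detector_False)
  qed
qed

lemma coherent_R: "coherent V (R_detector n \<Delta>)"
  unfolding coherent_def
proof (intro ballI allI impI)
  fix m m' b b'
  assume "R_detector n \<Delta> b m" "R_detector n \<Delta> b m'" "R_detector n \<Delta> b' m"
  with R_detector_unique[of b m b'] show "R_detector n \<Delta> b' m'" by simp
qed

lemma R_detector_divisor:
  assumes "R_detector n \<Delta> b (m + c)"
  shows "\<exists>b'. R_detector n \<Delta> b' m"
proof -
  obtain s e where b: "b = (s, e)" by (metis surj_pair)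
  show ?thesis
  proof (cases s)
    case True
    with assms b have "R_detector n \<Delta> (True, e) (m + c)" by simp
    then obtain F where F: "F \<in> facets \<Delta>" "m + c + sqfree_mon Y ({1..n} - F) = e + single (Z F) 1"
      "Gamma_mon n \<Delta> e" "\<forall>G. lookup (m + c) (Z G) = (if G = F then 1 else 0)"
      by (rule R_detector_TrueE) (rule that)
    let ?y = "sqfree_mon Y ({1..n} - F)"
    show ?thesis
    proof (cases "lookup m (Z F) = 0")
      case True
      then have "Z F \<in> keys c" using F(4)[rule_format, of F] by (simp add: in_keys_iff lookup_add)
      from mon_split_var[OF this] obtain c0 where c: "c = single (Z F) 1 + c0" by blast
      have "single (Z F) 1 + (m + (c0 + ?y)) = single (Z F) 1 + e"
        using F(2) unfolding c by (simp only: ac_simps)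
      then have "e = m + (c0 + ?y)" unfolding add_left_cancel ..
      then have "Gamma_mon n \<Delta> m" using F(3) Gamma_mon_divisor by metis
      then show ?thesis using R_detector_False by blast
    next
      case False
      then have "Z F \<in> keys m" by (simp add: in_keys_iff)
      from mon_split_var[OF this] obtain m0 where m: "m = single (Z F) 1 + m0" by blast
      have "single (Z F) 1 + ((m0 + ?y) + c) = single (Z F) 1 + e"
        using F(2) unfolding m by (simp only: ac_simps)
      then have "e = (m0 + ?y) + c" unfolding add_left_cancel ..
      then have "Gamma_mon n \<Delta> (m0 + ?y)" using F(3) Gamma_mon_divisor by metis
      then have "R_detector n \<Delta> (True, m0 + ?y) m"
        by (intro R_detector_TrueI[OF F(1)]) (simp_all add: m ac_simps)
      then show ?thesis by blast
    qed
  next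
    case False
    then have "Gamma_mon n \<Delta> (m + c)" using assms b by (auto simp: R_detector_False)
    then show ?thesis using Gamma_mon_divisor R_detector_False by blast
  qed
qed

lemma R_detector_compat:
  assumes "R_detector n \<Delta> b m" "R_detector n \<Delta> b m'" "R_detector n \<Delta> b' (m + c)"
  shows "R_detector n \<Delta> b' (m' + c)"
proof -
  obtain s e s' e' where b: "b = (s, e)" "b' = (s', e')" by (metis surj_pair)
  show ?thesis
  proof (cases s)
    case True
    with assms(1) b have "R_detector n \<Delta> (True, e) m" by simp
    then obtain F where F: "F \<in> facets \<Delta>" "m + sqfree_mon Y ({1..n} - F) = e + single (Z F) 1"
      "Gamma_mon n \<Delta> e" "\<forall>G. lookup m (Z G) = (if G = F then 1 else 0)" by (rule R_detector_TrueE) (rule that)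
    from assms(2) b True have "R_detector n \<Delta> (True, e) m'" by simp
    then obtain G where G: "G \<in> facets \<Delta>" "m' + sqfree_mon Y ({1..n} - G) = e + single (Z G) 1"
      by (rule R_detector_TrueE) (rule that)
    have s': s'
    proof (rule ccontr)
      assume "\<not> s'"
      then have "m + c \<in> mons (S_vars n)" using assms(3) b by (auto simp: R_detector_False Gamma_mon_def)
      then have "m \<in> mons (S_vars n)" by (simp add: mons_add_iff)
      then show False using S_vars_mon_no_Z[of m n F] F(4)[rule_format, of F] by simp
    qed
    with assms(3) b have "R_detector n \<Delta> (True, e') (m + c)" by simp
    then obtain H where H: "H \<in> facets \<Delta>" "m + c + sqfree_mon Y ({1..n} - H) = e' + single (Z H) 1"
      "Gamma_mon n \<Delta> e'" "\<forall>G. lookup (m + c) (Z G) = (if G = H then 1 else 0)" by (rule R_detector_TrueE) (rule that)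
    have "H = F" using H(4)[rule_format, of F] F(4)[rule_format, of F] by (simp add: lookup_add split: if_splits)
    have "(e + c) + single (Z F) 1 = (m + sqfree_mon Y ({1..n} - F)) + c"
      unfolding F(2) by (simp only: ac_simps)
    also have "\<dots> = e' + single (Z F) 1" using H(2) unfolding \<open>H = F\<close> by (simp only: ac_simps)
    finally have e': "e' = e + c" unfolding add_right_cancel ..
    have "m' + c + sqfree_mon Y ({1..n} - G) = (m' + sqfree_mon Y ({1..n} - G)) + c"
      by (simp only: ac_simps)
    also have "\<dots> = e' + single (Z G) 1" unfolding G(2) e' by (simp only: ac_simps)
    finally have "R_detector n \<Delta> (True, e') (m' + c)" using R_detector_TrueI G(1) H(3) by blast
    then show ?thesis using b s' by simp
  next
    case False
    then have "m = m'" using assms(1,2) b by (simp add: R_detector_False)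
    then show ?thesis using assms(3) by simp
  qed
qed

lemma R_detector_without_Z:
  assumes D: "R_detector n \<Delta> b q" and no_Z: "\<And>F. lookup q (Z F) = 0"
  shows "Gamma_mon n \<Delta> q"
proof -
  obtain s e where b: "b = (s, e)" by (metis surj_pair)
  show ?thesis
  proof (cases s)
    case True
    with D b have "R_detector n \<Delta> (True, e) q" by simp
    then obtain F where "\<forall>G. lookup q (Z G) = (if G = F then 1 else 0)"
      by (rule R_detector_TrueE) (rule that)
    then have "lookup q (Z F) = 1" by simp
    with no_Z[of F] show ?thesis by simp
  next
    case False
    with D b have "R_detector n \<Delta> (False, e) q" by simp
    then show ?thesis unfolding R_detector_False by simp
  qed
qed

lemma R_detector_with_Z:
  assumes D: "R_detector n \<Delta> b q" and Z: "lookup q (Z F) \<noteq> 0"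
  obtains e where "q + sqfree_mon Y ({1..n} - F) = e + single (Z F) 1" "Gamma_mon n \<Delta> e"
    "\<And>G. lookup q (Z G) = (if G = F then 1 else 0)"
proof -
  obtain s e where b: "b = (s, e)" by (metis surj_pair)
  have s
  proof (rule ccontr)
    assume "\<not> s"
    with D b have "R_detector n \<Delta> (False, e) q" by simp
    then have "q \<in> mons (S_vars n)" unfolding R_detector_False Gamma_mon_def by simp
    then show False using Z S_vars_mon_no_Z by simp
  qed
  with D b have "R_detector n \<Delta> (True, e) q" by simp
  then obtain H where H: "q + sqfree_mon Y ({1..n} - H) = e + single (Z H) 1" "Gamma_mon n \<Delta> e"
    "\<forall>G. lookup q (Z G) = (if G = H then 1 else 0)"
    by (rule R_detector_TrueE) (rule that)
  have "F = H" using H(3)[rule_format, of F] Z by (cases "F = H") simp_all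
  then show thesis using that[of e] H by simp
qed

lemma R_quads_undetected:
  assumes "q \<in> R_quads n \<Delta>"
  shows "\<not> R_detector n \<Delta> b q"
proof
  assume D: "R_detector n \<Delta> b q"
  from assms show False
  proof (cases rule: R_quads_cases)
    case (xy i)
    have "Gamma_mon n \<Delta> q"
      by (rule R_detector_without_Z[OF D]) (simp add: xy(2) lookup_add lookup_single_not_eq)
    then have "lookup q (X i) = 0 \<or> lookup q (Y i) = 0" by (simp add: Gamma_mon_def)
    moreover have "lookup q (X i) = 1" "lookup q (Y i) = 1"
      by (simp_all add: xy(2) lookup_add lookup_single_not_eq)
    ultimately show False by simp
  next
    case (xx i j)
    have "Gamma_mon n \<Delta> q"
      by (rule R_detector_without_Z[OF D]) (simp add: xx(5) lookup_add lookup_single_not_eq)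
    then have "{i. lookup q (X i) \<noteq> 0} \<in> \<Delta>" unfolding Gamma_mon_def by blast
    moreover have "{i, j} \<subseteq> {i. lookup q (X i) \<noteq> 0}" unfolding xx(5) by (simp add: lookup_add)
    ultimately have "{i, j} \<in> \<Delta>" by (rule subface[OF complex])
    with xx(4) show False ..
  next
    case (xz i F)
    have "lookup q (Z F) \<noteq> 0" unfolding xz(4) by (simp add: lookup_add)
    with D obtain e where e: "q + sqfree_mon Y ({1..n} - F) = e + single (Z F) 1" "Gamma_mon n \<Delta> e"
      by (rule R_detector_with_Z) (rule that)
    have eq: "lookup e v + lookup (single (Z F) 1) v = lookup q v + lookup (sqfree_mon Y ({1..n} - F)) v" for v
      using e(1) by (metis lookup_add)
    have "lookup e (X i) \<noteq> 0" using eq[of "X i"] by (simp add: xz(4) lookup_add lookup_single_not_eq)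
    moreover have "lookup e (Y i) \<noteq> 0"
      using eq[of "Y i"] xz(1,3) by (simp add: xz(4) lookup_add lookup_single_not_eq)
    moreover have "lookup e (X i) = 0 \<or> lookup e (Y i) = 0" using e(2) by (simp add: Gamma_mon_def)
    ultimately show False by simp
  next
    case (zz F G)
    have "lookup q (Z F) \<noteq> 0" unfolding zz(3) by (simp add: lookup_add)
    with D have Z: "\<forall>H. lookup q (Z H) = (if H = F then 1 else 0)"
      by (rule R_detector_with_Z) simp
    then have "lookup q (Z F) = 1" by simp
    then have "F \<noteq> G" unfolding zz(3) by (auto simp: lookup_add)
    then have "lookup q (Z G) = 0" using Z by simp
    then show False unfolding zz(3) by (simp add: lookup_add)
  qed
qed

lemma mdeg_R_quads: "q \<in> R_quads n \<Delta> \<Longrightarrow> mdeg q = 2"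
  unfolding R_quads_def by (auto simp: mdeg_add)

text \<open>Without a divisor from \<open>R_quads\<close>, the \<open>x\<close>-part is a face \<open>A\<close> disjoint from the \<open>y\<close>-part, and there
is at most one \<open>z\<^sub>F\<close>. In that case \<open>A \<subseteq> F\<close>, so multiplying by \<open>y\<^bsup>[n] - F\<^esup>\<close> keeps the monomial nonzero
in the face ring.\<close>

lemma detected_if_no_R_quad:
  assumes flag: "flag TYPE('k::field) n \<Delta>" and m: "m \<in> mons (T_vars n \<Delta>)"
    and no: "\<And>q c. q \<in> R_quads n \<Delta> \<Longrightarrow> m \<noteq> q + c"
  shows "\<exists>b. R_detector n \<Delta> b m"
proof -
  have keysX: "i \<in> {1..n}" if "lookup m (X i) \<noteq> 0" for i
  proof -
    have "X i \<in> keys m" using that by (simp add: in_keys_iff)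
    then show ?thesis using m by (auto simp: mons_def T_vars_def S_vars_def)
  qed
  have keysZ: "F \<in> facets \<Delta>" if "lookup m (Z F) \<noteq> 0" for F
  proof -
    have "Z F \<in> keys m" using that by (simp add: in_keys_iff)
    then show ?thesis using m by (auto simp: mons_def T_vars_def S_vars_def)
  qed
  have div: "\<exists>t. single u 1 + single v 1 \<notin> R_quads n \<Delta> \<or> lookup m t < lookup (single u 1 + single v 1) t" for u v
    using mon_cancel[of "single u 1 + single v 1" m] no by (meson not_less)
  have Z1: "lookup m (Z F) \<le> 1" for F
  proof (rule ccontr)
    assume "\<not> ?thesis"
    then show False using div[of "Z F" "Z F"] keysZ[of F]
      by (auto simp: lookup_add lookup_single when_def R_quads_def split: if_splits)
  qed
  have Z2: "F = G" if "lookup m (Z F) \<noteq> 0" "lookup m (Z G) \<noteq> 0" for F G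
  proof (rule ccontr)
    assume "F \<noteq> G"
    moreover have "single (Z F) 1 + single (Z G) 1 \<in> R_quads n \<Delta>"
      using that keysZ unfolding R_quads_def by blast
    ultimately show False using that div[of "Z F" "Z G"]
      by (auto simp: lookup_add lookup_single when_def split: if_splits)
  qed
  have XY: "lookup m (X i) = 0 \<or> lookup m (Y i) = 0" for i
  proof (rule ccontr)
    assume *: "\<not> ?thesis"
    then have "single (X i) 1 + single (Y i) 1 \<in> R_quads n \<Delta>"
      using keysX[of i] unfolding R_quads_def by blast
    then show False using * div[of "X i" "Y i"]
      by (auto simp: lookup_add lookup_single when_def split: if_splits)
  qed
  have XZ: "i \<in> F" if "lookup m (X i) \<noteq> 0" "lookup m (Z F) \<noteq> 0" for i F
  proof (rule ccontr)
    assume "i \<notin> F"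
    then have "single (X i) 1 + single (Z F) 1 \<in> R_quads n \<Delta>"
      using that keysX keysZ unfolding R_quads_def by blast
    then show False using that div[of "X i" "Z F"]
      by (auto simp: lookup_add lookup_single when_def split: if_splits)
  qed
  let ?A = "{i. lookup m (X i) \<noteq> 0}"
  have A: "?A \<in> \<Delta>"
  proof (rule ccontr)
    assume "?A \<notin> \<Delta>"
    then obtain i j where ij: "i \<in> ?A" "j \<in> ?A" "i \<noteq> j" "{i, j} \<notin> \<Delta>"
      using nonface_contains_nonedge[OF complex flag, of ?A] keysX by blast
    then have "single (X i) 1 + single (X j) 1 \<in> R_quads n \<Delta>"
      using keysX unfolding R_quads_def by blast
    then show False using ij div[of "X i" "X j"]
      by (auto simp: lookup_add lookup_single when_def split: if_splits)
  qed
  show ?thesis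
  proof (cases "\<exists>F. lookup m (Z F) \<noteq> 0")
    case False
    then have "Gamma_mon n \<Delta> m" using A XY mons_S_varsI[OF m] by (simp add: Gamma_mon_def)
    then show ?thesis using R_detector_False by blast
  next
    case True
    then obtain F where F: "lookup m (Z F) \<noteq> 0" by blast
    let ?y = "sqfree_mon Y ({1..n} - F)"
    from F have "Z F \<in> keys m" by (simp add: in_keys_iff)
    from mon_split_var[OF this] obtain m0 where m0: "m = m0 + single (Z F) 1" by (metis add.commute)
    \<comment> \<open>The detector is the image of \<open>m\<close>, in which \<open>z\<^sub>F\<close> is replaced by \<open>y\<^bsup>[n] - F\<^esup>\<close>.\<close>
    have lk: "lookup m v = lookup m0 v + (if v = Z F then 1 else 0)" for v
      unfolding m0 by (auto simp: lookup_add lookup_single when_def)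
    have "lookup m0 (Z G) = 0" for G
      using Z1[of F] Z2[OF F, of G] lk[of "Z G"] by (cases "G = F") (auto split: if_splits)
    then have "m0 \<in> mons (S_vars n)" using m mons_S_varsI[of m0 n \<Delta>] by (simp add: m0 mons_add_iff)
    moreover have "?y \<in> mons (S_vars n)" by (rule sqfree_mon_mons) (auto simp: S_vars_def)
    moreover have "{i. lookup (m0 + ?y) (X i) \<noteq> 0} = ?A"
      using lk by (auto simp: lookup_add)
    moreover have "lookup (m0 + ?y) (X i) = 0 \<or> lookup (m0 + ?y) (Y i) = 0" for i
      using XY[of i] XZ[OF _ F, of i] lk[of "X i"] lk[of "Y i"] by (auto simp: lookup_add)
    ultimately have "Gamma_mon n \<Delta> (m0 + ?y)" using A by (simp add: Gamma_mon_def mons_add_iff)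
    then have "R_detector n \<Delta> (True, m0 + ?y) m"
      by (intro R_detector_TrueI[OF keysZ[OF F]]) (simp_all add: m0 ac_simps)
    then show ?thesis by blast
  qed
qed

lemma y_complement_Un:
  assumes "F \<subseteq> {1..n}"
  shows "sqfree_mon Y ({1..n} - F \<inter> G) = sqfree_mon Y ({1..n} - F) + sqfree_mon Y (F - G)"
proof -
  have "{1..n} - F \<inter> G = ({1..n} - F) \<union> (F - G)" using assms by blast
  moreover have "finite (F - G)" using assms finite_subset by blast
  moreover have "({1..n} - F) \<inter> (F - G) = {}" by blast
  ultimately show ?thesis using sqfree_mon_Un[of "{1..n} - F" "F - G" Y] by simp
qed

text \<open>The common image \<open>e\<close> is divisible by \<open>y\<^bsup>[n] - F\<^esup>\<close> and \<open>y\<^bsup>[n] - G\<^esup>\<close>, hence by their least common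
multiple \<open>y\<^bsup>[n] - F \<inter> G\<^esup>\<close>. The quotient is the common factor \<open>c\<close>.\<close>

lemma fibre_R:
  assumes D: "R_detector n \<Delta> b m" "R_detector n \<Delta> b m'" and "m \<noteq> m'"
  shows "\<exists>F\<in>facets \<Delta>. \<exists>G\<in>facets \<Delta>. \<exists>c. F \<noteq> G \<and> m = c + (sqfree_mon Y (F - G) + single (Z F) 1) \<and>
        m' = c + (sqfree_mon Y (G - F) + single (Z G) 1)"
proof -
  obtain s e where b: "b = (s, e)" by (metis surj_pair)
  have s using D \<open>m \<noteq> m'\<close> unfolding b by (cases s) (auto simp: R_detector_False)
  with D b have D': "R_detector n \<Delta> (True, e) m" "R_detector n \<Delta> (True, e) m'" by simp_all
  from D'(1) obtain F where F: "F \<in> facets \<Delta>" "m + sqfree_mon Y ({1..n} - F) = e + single (Z F) 1"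
    by (rule R_detector_TrueE) (rule that)
  from D'(2) obtain G where G: "G \<in> facets \<Delta>" "m' + sqfree_mon Y ({1..n} - G) = e + single (Z G) 1"
    by (rule R_detector_TrueE) (rule that)
  have ne: "F \<noteq> G" using F(2) G(2) \<open>m \<noteq> m'\<close> by (metis add_right_cancel)
  have "lookup (sqfree_mon Y ({1..n} - F \<inter> G)) v \<le> lookup e v" for v
    using arg_cong[OF F(2), of "\<lambda>m. lookup m v"] arg_cong[OF G(2), of "\<lambda>m. lookup m v"]
    by (cases v) (auto simp: lookup_add lookup_single_not_eq split: if_splits)
  then obtain c where c: "e = sqfree_mon Y ({1..n} - F \<inter> G) + c" using mon_cancel by blast
  have "sqfree_mon Y ({1..n} - F) + m =
      sqfree_mon Y ({1..n} - F) + (c + (sqfree_mon Y (F - G) + single (Z F) 1))"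
    using F(2) unfolding c y_complement_Un[OF facet_subset[OF complex F(1)], of G] by (simp only: ac_simps)
  moreover have "sqfree_mon Y ({1..n} - G) + m' =
      sqfree_mon Y ({1..n} - G) + (c + (sqfree_mon Y (G - F) + single (Z G) 1))"
    using G(2) unfolding c Int_commute[of F G] y_complement_Un[OF facet_subset[OF complex G(1)], of F]
    by (simp only: ac_simps)
  ultimately show ?thesis using F(1) G(1) ne unfolding add_left_cancel by blast
qed

lemma exchange_detected_R:
  assumes "F \<in> facets \<Delta>" "G \<in> facets \<Delta>"
  shows "\<exists>b. R_detector n \<Delta> b (sqfree_mon Y (F - G) + single (Z F) 1) \<and>
      R_detector n \<Delta> b (sqfree_mon Y (G - F) + single (Z G) 1)"
proof -
  let ?e = "sqfree_mon Y ({1..n} - F \<inter> G)"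
  have e: "Gamma_mon n \<Delta> ?e"
    using empty_face[OF complex] by (auto simp: Gamma_mon_def S_vars_def intro!: sqfree_mon_mons)
  have e_F: "?e = sqfree_mon Y ({1..n} - F) + sqfree_mon Y (F - G)"
    by (rule y_complement_Un[OF facet_subset[OF complex assms(1)]])
  have e_G: "?e = sqfree_mon Y ({1..n} - G) + sqfree_mon Y (G - F)"
    using y_complement_Un[OF facet_subset[OF complex assms(2)], of F] by (simp only: Int_commute[of F G])
  have "R_detector n \<Delta> (True, ?e) (sqfree_mon Y (F - G) + single (Z F) 1)"
    by (rule R_detector_TrueI[OF assms(1) _ e], unfold e_F) (simp only: add.assoc add.commute add.left_commute)
  moreover have "R_detector n \<Delta> (True, ?e) (sqfree_mon Y (G - F) + single (Z G) 1)"
    by (rule R_detector_TrueI[OF assms(2) _ e], unfold e_G) (simp only: add.assoc add.commute add.left_commute)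
  ultimately show ?thesis by blast
qed

end


context
  fixes n :: nat and \<Delta> :: "nat set set"
  assumes complex: "simplicial_complex n \<Delta>" and pure: "pure \<Delta>"
    and flag: "flag TYPE('k::field) n \<Delta>"
begin

abbreviation K_R :: "(pvar, 'k) mpoly set" where
  "K_R \<equiv> detector_kernel (T_vars n \<Delta>) (R_detector n \<Delta>)"

lemma undetected_quadratic_R:
  assumes "m \<in> mons (T_vars n \<Delta>)" "\<And>b. \<not> R_detector n \<Delta> b m"
  shows "\<exists>q\<in>R_quads n \<Delta>. \<exists>c. m = q + c"
  using detected_if_no_R_quad[OF complex flag assms(1)] assms(2) by blast

lemma R_facet_detector:
  "facet_detector (T_vars n \<Delta>) (R_detector n \<Delta>) (facets \<Delta>) Y"
proof
  show "finite (T_vars n \<Delta>)" using finite_facets[OF complex] by (simp add: T_vars_def S_vars_def)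
  show "finite (facets \<Delta>)" by (rule finite_facets[OF complex])
  show "finite F" if "F \<in> facets \<Delta>" for F using finite_facet[OF complex that] .
  show "card F = card G" if "F \<in> facets \<Delta>" "G \<in> facets \<Delta>" for F G
    using card_facets[OF complex pure flag that] .
  show "inj Y" by (rule inj_Y)
  show "Y i \<noteq> Z F" for i F by simp
  show "Z F \<in> T_vars n \<Delta>" if "F \<in> facets \<Delta>" for F using that by (simp add: T_vars_def)
  show "Y i \<in> T_vars n \<Delta>" if "F \<in> facets \<Delta>" "i \<in> F" for F i
    using that facet_subset[OF complex] by (auto simp: T_vars_def S_vars_def)
  show "coherent (T_vars n \<Delta>) (R_detector n \<Delta>)" by (rule coherent_R[OF complex])
  show "\<exists>b'. R_detector n \<Delta> b' m" if "R_detector n \<Delta> b (m + c)" for m c b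
    by (rule R_detector_divisor[OF complex that])
  show "\<exists>l c. m = l + c \<and> mdeg l = 2 \<and> (\<forall>b. \<not> R_detector n \<Delta> b l)"
    if und: "m \<in> mons (T_vars n \<Delta>)" "\<And>b. \<not> R_detector n \<Delta> b m" for m
  proof -
    obtain q c where q: "q \<in> R_quads n \<Delta>" "m = q + c" using undetected_quadratic_R[OF und] by blast
    with R_quads_undetected[OF complex q(1)] mdeg_R_quads[OF complex q(1)] show ?thesis by blast
  qed
  show "\<exists>b. R_detector n \<Delta> b (sqfree_mon Y (F - G) + single (Z F) 1) \<and>
      R_detector n \<Delta> b (sqfree_mon Y (G - F) + single (Z G) 1)"
    if "F \<in> facets \<Delta>" "G \<in> facets \<Delta>" for F G
    by (rule exchange_detected_R[OF complex that])
qed (rule fibre_R[OF complex])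

lemma vars_subset: "x_vars n \<subseteq> S_vars n" "S_vars n \<subseteq> T_vars n \<Delta>"
  by (auto simp: x_vars_def S_vars_def T_vars_def)

lemma ideal_K_R: "ideal K_R (poly_ring (T_vars n \<Delta>))"
  by (rule detector_kernel_ideal[OF coherent_R[OF complex]])
    (rule R_detector_divisor[OF complex], assumption, rule R_detector_compat[OF complex])

lemma monomial_in_K_R:
  assumes "m \<in> mons (T_vars n \<Delta>)" "\<And>b. \<not> R_detector n \<Delta> b m"
  shows "monomial m \<in> K_R"
  unfolding monomial_def by (rule single_in_detector_kernel) (rule assms)+

lemma R_quads_mons: "R_quads n \<Delta> \<subseteq> mons (T_vars n \<Delta>)"
  by (auto simp: R_quads_def mons_add_iff T_vars_def S_vars_def)

lemma SR_gens_carrier: "{xprod F | F. F \<subseteq> {1..n} \<and> F \<notin> \<Delta>} \<subseteq> (carrier (poly_ring (x_vars n)) :: (pvar, 'k) mpoly set)"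
  using sqfree_X_mons by (auto simp: xprod_eq)

lemma SR_ideal_subset_K_R: "SR_ideal n \<Delta> \<subseteq> K_R"
  unfolding SR_ideal_def
proof (rule genideal_mono_ring[OF _ SR_gens_carrier _ ideal_K_R])
  show "x_vars n \<subseteq> T_vars n \<Delta>" using vars_subset by blast
  show "{xprod F | F. F \<subseteq> {1..n} \<and> F \<notin> \<Delta>} \<subseteq> K_R"
  proof clarify
    fix F assume F: "F \<subseteq> {1..n}" "F \<notin> \<Delta>"
    from nonface_contains_nonedge[OF complex flag F]
    obtain i j where ij: "i \<in> F" "j \<in> F" "i \<noteq> j" "{i, j} \<notin> \<Delta>" by blast
    have q: "single (X i) 1 + single (X j) 1 \<in> R_quads n \<Delta>"
      unfolding R_quads_def Un_iff mem_Collect_eq using ij F(1) by blast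
    have "finite F" using F(1) by (rule finite_subset) simp
    then have "sqfree_mon X F = sqfree_mon X {i, j} + sqfree_mon X (F - {i, j})"
      using sqfree_mon_Un[of "{i, j}" "F - {i, j}" X] ij(1,2) by (simp add: insert_absorb)
    also have "sqfree_mon X {i, j} = single (X i) 1 + single (X j) 1"
      using ij(3) by (simp add: sqfree_mon_def)
    finally have split: "sqfree_mon X F = (single (X i) 1 + single (X j) 1) + sqfree_mon X (F - {i, j})" .
    have "\<not> R_detector n \<Delta> b (sqfree_mon X F)" for b
    proof
      assume "R_detector n \<Delta> b (sqfree_mon X F)"
      from R_detector_divisor[OF complex this[unfolded split]] R_quads_undetected[OF complex q]
      show False by simp
    qed
    moreover have "sqfree_mon X F \<in> mons (T_vars n \<Delta>)"
      by (rule sqfree_mon_mons) (use F(1) in \<open>auto simp: T_vars_def S_vars_def\<close>)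
    ultimately show "xprod F \<in> K_R" unfolding xprod_eq by (intro monomial_in_K_R)
  qed
qed

lemma SR_ideal_carrier: "(SR_ideal n \<Delta> :: (pvar, 'k) mpoly set) \<subseteq> carrier (poly_ring (S_vars n))"
  unfolding SR_ideal_def
proof (rule genideal_mono_ring[OF vars_subset(1) SR_gens_carrier _ ring.oneideal[OF ring_poly_ring]])
  show "{xprod F | F. F \<subseteq> {1..n} \<and> F \<notin> \<Delta>} \<subseteq> (carrier (poly_ring (S_vars n)) :: (pvar, 'k) mpoly set)"
    using SR_gens_carrier carrier_mono[OF vars_subset(1)] by (rule order.trans)
qed

lemma var_mult: "var u * var v = (monomial (single u 1 + single v 1) :: (pvar, 'k) mpoly)"
  by (simp add: var_def monomial_mult)

lemma Gamma_gens_carrier: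
  "SR_ideal n \<Delta> \<union> {var (X i) * var (Y i) | i. i \<in> {1..n}} \<subseteq>
    (carrier (poly_ring (S_vars n)) :: (pvar, 'k) mpoly set)"
  using SR_ideal_carrier by (auto simp: var_mult mons_add_iff S_vars_def)

lemma quad_in_K_R: "q \<in> R_quads n \<Delta> \<Longrightarrow> monomial q \<in> K_R"
  using monomial_in_K_R R_quads_mons R_quads_undetected[OF complex] by blast

lemma Gamma_ideal_subset_K_R: "Gamma_ideal n \<Delta> \<subseteq> K_R"
  unfolding Gamma_ideal_def
proof (rule genideal_mono_ring[OF vars_subset(2) Gamma_gens_carrier _ ideal_K_R])
  have "var (X i) * var (Y i) \<in> K_R" if "i \<in> {1..n}" for i
    unfolding var_mult by (rule quad_in_K_R) (use that in \<open>auto simp: R_quads_def\<close>)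
  then show "SR_ideal n \<Delta> \<union> {var (X i) * var (Y i) | i. i \<in> {1..n}} \<subseteq> K_R"
    using SR_ideal_subset_K_R by blast
qed

abbreviation J_gens :: "(pvar, 'k) mpoly set" where
  "J_gens \<equiv> Gamma_ideal n \<Delta>
      \<union> {var (X i) * var (Z F) | i F. i \<in> {1..n} \<and> F \<in> facets \<Delta> \<and> i \<notin> F}
      \<union> {yprod (F - G) * var (Z F) - yprod (G - F) * var (Z G) | F G.
            F \<in> facets \<Delta> \<and> G \<in> facets \<Delta> \<and> F \<noteq> G}
      \<union> {var (Z F) * var (Z G) | F G. F \<in> facets \<Delta> \<and> G \<in> facets \<Delta>}"

lemma y_binomial: "yprod (F - G) * var (Z F) - yprod (G - F) * var (Z G) =
    (single (sqfree_mon Y (F - G) + single (Z F) 1) 1 - single (sqfree_mon Y (G - F) + single (Z G) 1) 1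
      :: (pvar, 'k) mpoly)"
  by (simp add: yprod_eq var_def monomial_mult) (simp add: monomial_def)

lemma exch_mons_T:
  "F \<in> facets \<Delta> \<Longrightarrow> sqfree_mon Y (F - G) + single (Z F) 1 \<in> mons (T_vars n \<Delta>)"
  using facet_subset[OF complex] by (fastforce simp: mons_add_iff T_vars_def S_vars_def intro!: sqfree_mon_mons)

lemma J_gens_subset_K_R: "J_gens \<subseteq> K_R"
proof -
  have "var (X i) * var (Z F) \<in> K_R" if "i \<in> {1..n}" "F \<in> facets \<Delta>" "i \<notin> F" for i F
    unfolding var_mult by (rule quad_in_K_R) (use that in \<open>auto simp: R_quads_def\<close>)
  moreover have "var (Z F) * var (Z G) \<in> K_R" if "F \<in> facets \<Delta>" "G \<in> facets \<Delta>" for F G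
    unfolding var_mult by (rule quad_in_K_R) (use that in \<open>auto simp: R_quads_def\<close>)
  moreover have "yprod (F - G) * var (Z F) - yprod (G - F) * var (Z G) \<in> K_R"
    if FG: "F \<in> facets \<Delta>" "G \<in> facets \<Delta>" for F G
  proof -
    obtain b where "R_detector n \<Delta> b (sqfree_mon Y (F - G) + single (Z F) 1)"
      "R_detector n \<Delta> b (sqfree_mon Y (G - F) + single (Z G) 1)"
      using exchange_detected_R[OF complex FG] by blast
    from coherentD[OF coherent_R[OF complex] exch_mons_T[OF FG(1)] exch_mons_T[OF FG(2)] this]
    show ?thesis unfolding y_binomial
      by (rule binomial_in_detector_kernel[OF exch_mons_T[OF FG(1)] exch_mons_T[OF FG(2)]])
  qed
  ultimately show ?thesis using Gamma_ideal_subset_K_R by blast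
qed

lemma J_gens_subset_J: "J_gens \<subseteq> J_ideal n \<Delta>"
  unfolding J_ideal_def
  by (rule ring.genideal_self[OF ring_poly_ring order.trans[OF J_gens_subset_K_R detector_kernel_carrier]])

lemma quad_in_J:
  assumes "q \<in> R_quads n \<Delta>" shows "(monomial q :: (pvar, 'k) mpoly) \<in> J_ideal n \<Delta>"
proof -
  have Gamma: "p \<in> J_ideal n \<Delta>"
    if "p \<in> SR_ideal n \<Delta> \<union> {var (X i) * var (Y i) | i. i \<in> {1..n}}" for p :: "(pvar, 'k) mpoly"
  proof -
    have "p \<in> Gamma_ideal n \<Delta>"
      unfolding Gamma_ideal_def using ring.genideal_self[OF ring_poly_ring Gamma_gens_carrier] that by (rule subsetD)
    then show ?thesis by (intro subsetD[OF J_gens_subset_J] UnI1)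
  qed
  from assms show ?thesis
  proof (cases rule: R_quads_cases)
    case (xy i)
    then show ?thesis unfolding xy(2) var_mult[symmetric] by (intro Gamma UnI2) blast
  next
    case (xx i j)
    have "xprod {i, j} \<in> (SR_ideal n \<Delta> :: (pvar, 'k) mpoly set)"
      unfolding SR_ideal_def
      by (rule subsetD[OF ring.genideal_self[OF ring_poly_ring SR_gens_carrier]]) (use xx(1,2,4) in blast)
    moreover have "xprod {i, j} = (monomial q :: (pvar, 'k) mpoly)"
      using xx(3) by (simp add: xprod_def var_mult xx(5))
    ultimately show ?thesis by (intro Gamma UnI1) simp
  next
    case (xz i F)
    then show ?thesis unfolding xz(4) var_mult[symmetric]
      by (intro subsetD[OF J_gens_subset_J] UnI1[OF UnI1[OF UnI2]]) blast
  next
    case (zz F G)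
    then show ?thesis unfolding zz(3) var_mult[symmetric]
      by (intro subsetD[OF J_gens_subset_J] UnI2) blast
  qed
qed

lemma ideal_J: "ideal (J_ideal n \<Delta> :: (pvar, 'k) mpoly set) (poly_ring (T_vars n \<Delta>))"
  unfolding J_ideal_def
  by (rule ring.genideal_ideal[OF ring_poly_ring order.trans[OF J_gens_subset_K_R detector_kernel_carrier]])

text \<open>The kernel is an ideal that contains the generators. Conversely, the kernel is spanned by
undetected monomials, which are multiples of \<open>R_quads\<close>, and by binomials with a common detector,
which \<open>fibre_R\<close> exhibits as multiples of the exchange generators.\<close>

lemma J_ideal_eq_detector_kernel: "J_ideal n \<Delta> = K_R"
proof
  show "J_ideal n \<Delta> \<subseteq> K_R"
    unfolding J_ideal_def by (rule ring.genideal_minimal[OF ring_poly_ring ideal_K_R J_gens_subset_K_R])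
  note J = ideal_poly_ringD[OF ideal_J]
  show "K_R \<subseteq> J_ideal n \<Delta>"
  proof
    fix p assume "p \<in> K_R"
    then show "p \<in> J_ideal n \<Delta>"
      using coherent_R[OF complex]
    proof (induction rule: detector_kernel_induct)
      case zero
      show ?case by (rule J(2))
    next
      case (monom p m k)
      obtain q c where qc: "q \<in> R_quads n \<Delta>" "m = q + c"
        using undetected_quadratic_R[OF monom.hyps] by blast
      have "c \<in> mons (T_vars n \<Delta>)" using monom.hyps(1) qc(2) by (simp add: mons_add_iff)
      then have "single c k * monomial q \<in> J_ideal n \<Delta>"
        by (intro J(4)[OF quad_in_J[OF qc(1)]]) (simp add: carrier_iff)
      then have "single m k \<in> J_ideal n \<Delta>"
        by (simp add: qc(2) monomial_def mult_single add.commute)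
      then show ?case by (rule J(3)[OF monom.IH])
    next
      case (binom p m m' b k)
      obtain F G c where FG: "F \<in> facets \<Delta>" "G \<in> facets \<Delta>" "F \<noteq> G"
        "m = c + (sqfree_mon Y (F - G) + single (Z F) 1)" "m' = c + (sqfree_mon Y (G - F) + single (Z G) 1)"
        using fibre_R[OF complex binom.hyps(4,5,3)] by blast
      have c: "c \<in> mons (T_vars n \<Delta>)" using binom.hyps(1) FG(4) by (simp only: mons_add_iff)
      have "yprod (F - G) * var (Z F) - yprod (G - F) * var (Z G) \<in> (J_ideal n \<Delta> :: (pvar, 'k) mpoly set)"
        
        by (rule subsetD[OF J_gens_subset_J], rule UnI1, rule UnI2) (use FG(1-3) in blast)
      from J(4)[OF this, of "single c k"] c have "single m k - single m' k \<in> J_ideal n \<Delta>"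
        unfolding y_binomial FG(4,5) by (simp add: carrier_iff right_diff_distrib mult_single)
      then show ?case by (rule J(3)[OF binom.IH])
    qed
  qed
qed

theorem R_has_quadratic_GB_iff:
  "R_has_quadratic_GB TYPE('k) n \<Delta> \<longleftrightarrow> (\<exists>Fs. set Fs = facets \<Delta> \<and> exchange_ordered Fs)"
  unfolding R_has_quadratic_GB_def J_ideal_eq_detector_kernel
  by (rule facet_detector.quadratic_GB_iff_exchange_order[OF R_facet_detector])

end

theorem proposition8p3:
  fixes n :: nat and \<Delta> :: "nat set set"
  assumes "simplicial_complex n \<Delta>"
    and "pure \<Delta>"
    and "flag TYPE('k::field_char_0) n \<Delta>"
  shows "(A_has_quadratic_GB TYPE('k) n \<Delta> \<longleftrightarrow> R_has_quadratic_GB TYPE('k) n \<Delta>) \<and>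
         (R_has_quadratic_GB TYPE('k) n \<Delta> \<longleftrightarrow> shellable \<Delta>)"
  using A_has_quadratic_GB_iff[OF assms] R_has_quadratic_GB_iff[OF assms]
    shellable_iff_exchange_order[OF assms(1,2)] by simp

end
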